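(* For every integer $n\ge 0$, $$\mathrm{spt}_{\omega}(10n+7)\equiv 0\pmod 5\qquad\text{and}\qquad \mathrm{spt}_{\omega}(10n+9)\equiv 0\pmod 5.$$
   Context: For a positive integer $m$, $\mathrm{spt}_{\omega}(m)$ denotes the total number of appearances of the smallest part (counted with multiplicity), summed over all partitions of $m$ into positive parts in which every odd part is less than twice the smallest part. Equivalently, as power series, $$\sum_{m=1}^{\infty}\mathrm{spt}_{\omega}(m)q^m=\sum_{m=1}^{\infty}\frac{q^m}{(1-q^m)^2(q^{m+1};q)_m(q^{2m+2};q^2)_{\infty}},$$ where $(a;q)_k:=\prod_{j=0}^{k-1}(1-aq^j)$ and $(a;q)_\infty:=\prod_{j=0}^{\infty}(1-aq^j)$. *)

theory Defs
  imports "HOL-Library.Multiset" "HOL-Number_Theory.Cong"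
begin

(* A partition of m is a finite multiset of positive naturals with sum m. For m = 0 the only
   member is the empty multiset, for which Min is unspecified but the condition is vacuous. *)
definition omega_partitions :: "nat \<Rightarrow> nat multiset set" where
  "omega_partitions m =
     {p. (\<forall>k \<in># p. 0 < k) \<and> sum_mset p = m \<and>
         (\<forall>k \<in># p. odd k \<longrightarrow> k < 2 * Min (set_mset p))}"

definition spt_omega :: "nat \<Rightarrow> nat" where
  "spt_omega m = (\<Sum>p \<in> omega_partitions m. count p (Min (set_mset p)))"

(* The sum defining spt_omega is over a finite set, so it is not 0 by convention. *)
lemma finite_omega_partitions: "finite (omega_partitions m)"
proof -
  have size_le: "(\<forall>k \<in># p. 0 < k) \<Longrightarrow> size p \<le> sum_mset p" for p :: "nat multiset"
    by (induction p) auto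
  have part_le: "k \<le> sum_mset p" if "k \<in># p" for k and p :: "nat multiset"
    using sum_mset.remove[OF that] by simp
  have "omega_partitions m \<subseteq> mset ` {xs. set xs \<subseteq> {..m} \<and> length xs \<le> m}"
  proof
    fix p assume p: "p \<in> omega_partitions m"
    obtain xs where xs: "mset xs = p" using ex_mset by blast
    from p have "size p \<le> m" and "set_mset p \<subseteq> {..m}"
      using size_le[of p] part_le[of _ p] by (auto simp: omega_partitions_def)
    then have "set xs \<subseteq> {..m} \<and> length xs \<le> m"
      by (simp only: set_mset_mset size_mset xs[symmetric] simp_thms)
    with xs show "p \<in> mset ` {xs. set xs \<subseteq> {..m} \<and> length xs \<le> m}" by blast
  qed
  then show ?thesis
    by (rule finite_subset) (simp add: finite_lists_length_le)
qed

end

theory Submission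
  imports Defs "HOL-Computational_Algebra.Formal_Laurent_Series" "Berlekamp_Zassenhaus.Finite_Field"
begin

text \<open>
  Write \<open>E(q) = (q;q)\<^sub>\<infinity>\<close>. Sorting partitions by their smallest part \<open>n\<close> shows that the generating
  function of \<open>spt\<^sub>\<omega>\<close> is \<open>1 / E(q\<^sup>2)\<close> times \<open>\<Sum> q\<^sup>n (q;q)\<^bsub>n-1\<^esub>\<^sup>2 \<beta>\<^sub>n\<close>, where \<open>\<beta>\<^sub>n = (-q;q)\<^sub>n / (q;q)\<^bsub>2n\<^esub>\<close>
  belongs to a Bailey pair whose \<open>\<alpha>\<close> vanishes at odd indices. A telescoping form of Bailey's lemma turns the
  sum into \<open>\<Sum> q\<^sup>n / (1 - q\<^sup>n)\<^sup>2\<close> plus an even function of \<open>q\<close>, so the odd part of the generating function is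
  the one of \<open>1 / E(q\<^sup>2) \<Sum> q\<^sup>n / (1 - q\<^sup>n)\<^sup>2\<close>. A special case of Jackson's \<open>\<^sub>8\<phi>\<^sub>7\<close> sum, proved by a WZ pair,
  evaluates that odd part as \<open>q E(q\<^sup>4)\<^sup>3 / (q\<^sup>2;q\<^sup>4)\<^sub>\<infinity>\<^sup>5\<close>. Modulo 5 the denominator is a series in \<open>q\<^bsup>10\<^esup>\<close>,
  and Jacobi's formula for the cube leaves only exponents \<open>1 + 2k(k+1)\<close>, which are 1, 3 or 5 modulo 10.

  Infinite products and sums are replaced throughout by finite ones and congruences modulo powers of \<open>q\<close>;
  coefficients are taken in the field with five elements.
\<close>

section \<open>Finite q-series identities\<close>

definition qf :: "'a::comm_ring_1 \<Rightarrow> nat \<Rightarrow> 'a" where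
  "qf q n = (\<Prod>i=1..n. 1 - q ^ i)"

lemma qf_0 [simp]: "qf q 0 = 1" by (simp add: qf_def)
lemma qf_Suc: "qf q (Suc n) = qf q n * (1 - q ^ Suc n)" by (simp add: qf_def)

definition oddf :: "'a::comm_ring_1 \<Rightarrow> nat \<Rightarrow> 'a" where
  "oddf q n = (\<Prod>i<n. 1 - q ^ (2 * i + 1))"

lemma oddf_0 [simp]: "oddf q 0 = 1" by (simp add: oddf_def)
lemma oddf_Suc: "oddf q (Suc n) = oddf q n * (1 - q ^ (2 * n + 1))" by (simp add: oddf_def)

lemma qf_double: "qf q (2 * n) = oddf q n * qf (q\<^sup>2) n"
  proof (induction n)
  case (Suc n)
  have "qf q (2 * Suc n) = qf q (2 * n) * (1 - q ^ (2 * n + 1)) * (1 - q ^ (2 * Suc n))"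
    by (simp add: qf_Suc)
  also have "\<dots> = oddf q (Suc n) * qf (q\<^sup>2) (Suc n)"
    unfolding power_mult[of q 2 "Suc n"] Suc.IH oddf_Suc qf_Suc by (simp only: mult_ac)
  finally show ?case .
qed simp

text \<open>The algebra of the WZ pair in \<open>wz_sum\<close>, where \<open>Y = q^(2N)\<close>,
  \<open>x = q^(2k+1)\<close>, \<open>p = q^k\<close>, and \<open>w\<close>, \<open>W\<close>,
  \<open>v\<close>, \<open>V\<close> are \<open>wq\<close> at \<open>N + k\<close>,
  \<open>N + k + 1\<close>, \<open>N - k - 1\<close>, \<open>N - k\<close>. With abstract field
  elements it is an identity of rational functions.\<close>

lemma wz_step:
  fixes Y x p W V w v q :: "'a :: field"
  assumes nz: "x \<noteq> 0" "q \<noteq> 0" "p \<noteq> 0" "1 - x \<noteq> 0" "1 - q * Y * x \<noteq> 0" "x - q * Y \<noteq> 0" "1 - Y \<noteq> 0" "1 - q * Y \<noteq> 0"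
    and W: "W = w * (1 - Y * x) / (1 - q * Y * x)" and V: "V = v * (1 - Y / x) / (1 - q * Y / x)"
    and x: "x = q * p\<^sup>2"
  shows "(1 - q * Y)\<^sup>2 * (p * (1 + x) / (1 - x)\<^sup>2 * W * V) - (1 - Y)\<^sup>2 * (p * (1 + x) / (1 - x)\<^sup>2 * w * v) =
    Y * (1 - q * Y\<^sup>2) / ((1 - Y) * (1 - q * Y)) * (q * p - inverse (q * p)) * (W * v)
    - Y * (1 - q * Y\<^sup>2) / ((1 - Y) * (1 - q * Y)) * (p - inverse p) * (w * V)"
proof -
  define c where "c = w * v / ((1 - q * Y * x) * (x - q * Y))"
  have V': "V = v * (x - Y) / (x - q * Y)"
    unfolding V using nz by (simp add: field_simps)
  have "(1 - q * Y)\<^sup>2 * (p * (1 + x) / (1 - x)\<^sup>2 * W * V) - (1 - Y)\<^sup>2 * (p * (1 + x) / (1 - x)\<^sup>2 * w * v)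
    = c * p * (1 + x) / (1 - x)\<^sup>2 * ((1 - q * Y)\<^sup>2 * (1 - Y * x) * (x - Y) - (1 - Y)\<^sup>2 * (1 - q * Y * x) * (x - q * Y))"
    unfolding W V' c_def using nz(5,6) by (simp add: divide_simps) (simp add: algebra_simps)
  \<comment> \<open>The difference is divisible by \<open>(1 - x)^2\<close>, which removes the
    denominator of the summand.\<close>
  also have "(1 - q * Y)\<^sup>2 * (1 - Y * x) * (x - Y) - (1 - Y)\<^sup>2 * (1 - q * Y * x) * (x - q * Y)
     = (1 - x)\<^sup>2 * (Y * (q - 1) * (1 - q * Y\<^sup>2))"
    by (simp add: power2_eq_square algebra_simps)
  also have "c * p * (1 + x) / (1 - x)\<^sup>2 * ((1 - x)\<^sup>2 * (Y * (q - 1) * (1 - q * Y\<^sup>2))) =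
     c * p * (1 + x) * (Y * (q - 1) * (1 - q * Y\<^sup>2))"
    using nz(4) by simp
  also have "\<dots> = Y * (1 - q * Y\<^sup>2) / ((1 - Y) * (1 - q * Y)) * c *
      ((q * p - inverse (q * p)) * (1 - Y * x) * (x - q * Y) - (p - inverse p) * (1 - q * Y * x) * (x - Y))"
  proof -
    \<comment> \<open>Substituting \<open>x = q p^2\<close> makes the cross difference on the side
      of the mate collapse to the same product.\<close>
    have X: "(q * p - inverse (q * p)) * (1 - Y * x) * (x - q * Y) - (p - inverse p) * (1 - q * Y * x) * (x - Y)
      = p * (1 + x) * (q - 1) * ((1 - Y) * (1 - q * Y))"
      unfolding x using nz(2,3) by (simp add: field_simps power2_eq_square)
    have cancel: "A / D * c * (B * D) = A * c * B" if "D \<noteq> 0" for A B D :: 'a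
      using that by simp
    have "(1 - Y) * (1 - q * Y) \<noteq> 0" using nz(7,8) by simp
    then show ?thesis unfolding X by (subst cancel) (simp_all only: mult_ac simp_thms)
  qed
  also have "\<dots> = Y * (1 - q * Y\<^sup>2) / ((1 - Y) * (1 - q * Y)) * (q * p - inverse (q * p)) * (W * v)
    - Y * (1 - q * Y\<^sup>2) / ((1 - Y) * (1 - q * Y)) * (p - inverse p) * (w * V)"
  proof -
    have 1: "W * v = c * ((1 - Y * x) * (x - q * Y))" and 2: "w * V = c * ((1 - q * Y * x) * (x - Y))"
      unfolding W V' c_def using nz(5,6) by (simp_all add: divide_simps)
    have "K * c * (P * A * B - P' * A' * B') = K * P * (c * (A * B)) - K * P' * (c * (A' * B'))"
      for K P A B P' A' B' :: 'a by (simp only: right_diff_distrib mult_ac)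
    then show ?thesis unfolding 1 2 .
  qed
  finally show ?thesis .
qed

section \<open>Reciprocal q-factorials and Bailey's lemma\<close>

locale not_root_of_unity =
  fixes q :: "'a::field"
  assumes q_nz: "q \<noteq> 0" and not_root: "n > 0 \<Longrightarrow> q ^ n \<noteq> 1"
begin

lemma qf_nz [simp]: "qf q n \<noteq> 0"
  using not_root by (auto simp: qf_def prod_zero_iff)

lemma qf_sq_nz [simp]: "qf (q\<^sup>2) n \<noteq> 0"
  using not_root by (auto simp: qf_def prod_zero_iff power_mult[symmetric])

lemma oddf_nz [simp]: "oddf q n \<noteq> 0"
  using not_root[of "Suc _"] by (auto simp: oddf_def prod_zero_iff)

text \<open>The reciprocal of the q-factorial, continued by zero to negative integers, so that
  the recurrence below holds without side conditions.\<close>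

definition iqf :: "int \<Rightarrow> 'a" where
  "iqf k = (if k < 0 then 0 else inverse (qf q (nat k)))"

lemma iqf_neg [simp]: "k < 0 \<Longrightarrow> iqf k = 0" by (simp add: iqf_def)

lemma iqf_nat: "iqf (int n) = inverse (qf q n)" by (simp add: iqf_def)

lemma iqf_rec: "iqf (k - 1) = (1 - q powi k) * iqf k"
proof (cases "k > 0")
  case True
  define n where "n = nat (k - 1)"
  have k: "k = int (Suc n)" using True by (simp add: n_def)
  have "1 - q ^ Suc n \<noteq> 0" using not_root[of "Suc n"] by auto
  moreover have "q powi k = q ^ Suc n" unfolding k by (simp only: power_int_of_nat)
  moreover have "iqf k = inverse (qf q (Suc n))" unfolding k iqf_nat ..
  moreover have "k - 1 = int n" using k by simp
  ultimately show ?thesis by (simp add: iqf_nat qf_Suc field_simps del: power_Suc)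
qed (auto simp: iqf_def)

text \<open>The kernel of a Bailey pair relative to 1: \<open>beta_n\<close> is the sum of
  \<open>alpha_j * pq n j\<close>. Integer indices allow sums over any range containing the
  support.\<close>

definition pq :: "int \<Rightarrow> int \<Rightarrow> 'a" where
  "pq n j = iqf (n - j) * iqf (n + j)"

lemma pq_outside: "n < \<bar>j\<bar> \<Longrightarrow> pq n j = 0"
  by (auto simp: pq_def abs_if split: if_splits)

lemma pq_minus: "pq n (- j) = pq n j"
  by (simp add: pq_def)

text \<open>By \<open>iqf_rec\<close> every product is a multiple of \<open>iqf u * iqf v\<close>,
  which leaves an identity in \<open>q^u\<close>, \<open>q^v\<close> and \<open>q\<close>. It
  changes the upper index of a kernel at the price of neighbouring lower indices, both for
  \<open>pq\<close> and for \<open>cq\<close>.\<close>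

lemma iqf_rec2:
  "(1 - q powi (u + v)) * (1 - q powi (u + v - 1)) * (iqf u * iqf v) =
    q powi u * (iqf u * iqf (v - 2)) + (1 + q powi (u + v - 1)) * (iqf (u - 1) * iqf (v - 1))
    + q powi v * (iqf (u - 2) * iqf v)"
proof -
  define a b where "a = q powi u" and "b = q powi v"
  have 1: "iqf (u - 1) = (1 - a) * iqf u" "iqf (v - 1) = (1 - b) * iqf v"
    by (simp_all add: iqf_rec a_def b_def)
  have 2: "iqf (u - 2) = (1 - a / q) * ((1 - a) * iqf u)" "iqf (v - 2) = (1 - b / q) * ((1 - b) * iqf v)"
    using iqf_rec[of "u - 1"] iqf_rec[of "v - 1"] 1 q_nz by (simp_all add: a_def b_def power_int_diff)
  have ab: "q powi (u + v) = a * b" "q powi (u + v - 1) = a * b / q"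
    unfolding a_def b_def using q_nz by (simp_all add: power_int_add power_int_diff)
  show ?thesis
    unfolding 1 2 ab a_def[symmetric] b_def[symmetric]
    using q_nz by (simp add: field_simps)
qed

lemma pq_rec:
  fixes n j :: int
  shows "(1 - q powi (2 * n)) * (1 - q powi (2 * n - 1)) * pq n j =
    q powi (n - j) * pq (n - 1) (j - 1) + (1 + q powi (2 * n - 1)) * pq (n - 1) j
    + q powi (n + j) * pq (n - 1) (j + 1)"
  using iqf_rec2[of "n - j" "n + j"] by (simp add: pq_def algebra_simps)

text \<open>Both sides equal \<open>iqf (n - j - 1) * iqf (n + j)\<close>.\<close>

lemma pq_step: "(1 - q powi (n - j)) * pq n j = (1 - q powi (n + j + 1)) * pq n (j + 1)"
proof -
  have "(1 - q powi (n - j)) * pq n j = iqf (n - j - 1) * iqf (n + j)"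
    by (simp add: pq_def iqf_rec)
  also have "iqf (n + j) = (1 - q powi (n + j + 1)) * iqf (n + j + 1)"
    using iqf_rec[of "n + j + 1"] by simp
  also have "n - j - 1 = n - (j + 1)" by simp
  finally show ?thesis by (simp only: pq_def mult_ac add.assoc)
qed

text \<open>An instance of Bailey's lemma, in which the sum telescopes.\<close>
lemma bailey_sum:
  assumes "j > 0"
  shows "(\<Sum>n=1..N. q ^ n * (qf q (n - 1))\<^sup>2 * pq (int n) (int j)) =
     q ^ j / (1 - q ^ j)\<^sup>2 * (qf q N)\<^sup>2 * pq (int N) (int j)"
proof (induction N)
  case 0
  then show ?case using assms by (simp add: pq_outside)
next
  case (Suc N)
  define a where "a = q powi (int (Suc N) - int j)"
  define c where "c = q ^ j"
  have c: "c \<noteq> 0" "1 - c \<noteq> 0" using q_nz not_root[OF assms] by (auto simp: c_def)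
  have Q: "q ^ Suc N = a * c"
    using q_nz by (simp add: a_def c_def power_int_diff power_int_of_nat del: of_nat_Suc)
  have b: "q powi (int (Suc N) + int j) = a * c\<^sup>2"
    using q_nz Q by (simp add: c_def power_int_add power_int_of_nat power2_eq_square del: of_nat_Suc)
  have P: "pq (int N) (int j) = (1 - a) * (1 - a * c\<^sup>2) * pq (int (Suc N)) (int j)"
  proof -
    have "iqf (int N - int j) = (1 - a) * iqf (int (Suc N) - int j)"
      using iqf_rec[of "int (Suc N) - int j"] by (simp add: a_def)
    moreover have "iqf (int N + int j) = (1 - a * c\<^sup>2) * iqf (int (Suc N) + int j)"
      using iqf_rec[of "int (Suc N) + int j"] unfolding b by simp
    ultimately show ?thesis by (simp only: pq_def mult_ac)
  qed
  have "(\<Sum>n=1..Suc N. q ^ n * (qf q (n - 1))\<^sup>2 * pq (int n) (int j)) =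
     c / (1 - c)\<^sup>2 * (qf q N)\<^sup>2 * pq (int N) (int j) + (a * c) * (qf q N)\<^sup>2 * pq (int (Suc N)) (int j)"
    using Suc by (simp add: c_def[symmetric] Q del: power_Suc of_nat_Suc)
  also have "\<dots> = (qf q N)\<^sup>2 * pq (int (Suc N)) (int j) * (c / (1 - c)\<^sup>2 * (1 - a) * (1 - a * c\<^sup>2) + a * c)"
    unfolding P by (simp only: distrib_left distrib_right mult_1_left mult_ac)
  \<comment> \<open>This keeps the partial sum in closed form:
    \<open>(1 - a)(1 - a c^2) + a (1 - c)^2 = (1 - a c)^2\<close>, and \<open>1 - a c\<close> is the
    new factor of \<open>qf q (Suc N)\<close>.\<close>
  also have "c / (1 - c)\<^sup>2 * (1 - a) * (1 - a * c\<^sup>2) + a * c = c / (1 - c)\<^sup>2 * (1 - a * c)\<^sup>2"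
    using c by (simp add: divide_simps) (simp add: power2_eq_square algebra_simps)
  finally show ?case
    unfolding qf_Suc Q power_mult_distrib c_def[symmetric] by (simp only: mult_ac)
qed

section \<open>A Bailey pair supported on even indices\<close>

text \<open>The member \<open>\<beta>\<^sub>n\<close> of the Bailey pair relative to 1 with \<open>\<alpha>\<close> supported on even indices, its two halves
  \<open>q\<^bsup>3r\<^sup>2-r\<^esup>\<close> and \<open>q\<^bsup>3r\<^sup>2+r\<^esup>\<close> being spread over \<open>r\<close> and \<open>-r\<close>.\<close>

definition beta_sum :: "nat \<Rightarrow> 'a" where
  "beta_sum n = (\<Sum>r=-int n..int n. (-1) powi r * q powi (3 * r\<^sup>2 - r) * pq (int n) (2 * r))"

lemma beta_sum_eq:
  assumes "L \<ge> int n"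
  shows "beta_sum n = (\<Sum>r=-L..L. (-1) powi r * q powi (3 * r\<^sup>2 - r) * pq (int n) (2 * r))"
  unfolding beta_sum_def using assms
  by (intro sum.mono_neutral_left) (auto simp: pq_outside)

lemma sum_int_reflect:
  fixes g :: "int \<Rightarrow> 'b::comm_monoid_add"
  shows "(\<Sum>r=-L..L. g r) = (\<Sum>r=-L..L. g (- r))"
  by (rule sum.reindex_bij_witness[of _ uminus uminus]) auto

lemma minus_one_powi_minus: "(- 1 :: 'a) powi (- r) = (- 1) powi r"
  by (rule power_int_minus_one_minus)

text \<open>The reflection \<open>r -> -1 - r\<close> fixes the exponent \<open>3r^2 + 3r\<close>
  and, by the symmetry of \<open>pq\<close>, the kernel at \<open>2r + 1\<close>, but flips the
  sign.\<close>

lemma odd_theta_zero: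
  assumes "L > int n"
  shows "(\<Sum>r=-L..L. (-1) powi r * q powi (3 * r\<^sup>2 + 3 * r) * pq (int n) (2 * r + 1)) = 0"
    (is "sum ?g _ = 0")
proof -
  have anti: "?g (- 1 - r) = - ?g r" for r
  proof -
    have "(- 1 :: 'a) powi (- 1 - r) = - ((- 1) powi r)"
    proof -
      have "- 1 - r = - (r + 1)" by simp
      then have "(- 1 :: 'a) powi (- 1 - r) = (- 1) powi (r + 1)" by (simp only: minus_one_powi_minus)
      then show ?thesis by (simp add: power_int_add)
    qed
    moreover have "3 * (- 1 - r)\<^sup>2 + 3 * (- 1 - r) = 3 * r\<^sup>2 + 3 * r"
      by (simp add: power2_eq_square algebra_simps)
    moreover have "pq (int n) (2 * (- 1 - r) + 1) = pq (int n) (2 * r + 1)"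
      using pq_minus[of "int n" "2 * r + 1"] by (simp add: algebra_simps)
    ultimately show ?thesis by (simp only: mult_minus_left)
  qed
  have "sum ?g {-L..L} = sum ?g {-L..-1} + sum ?g {0..L}"
    by (subst sum.union_disjoint[symmetric]) (use assms in \<open>auto intro!: sum.cong\<close>)
  \<comment> \<open>The range is not closed under the reflection; its unpaired term
    \<open>r = L\<close> vanishes since \<open>2L + 1 > n\<close>.\<close>
  also have "sum ?g {0..L} = sum ?g {0..L - 1}"
    using assms by (intro sum.mono_neutral_right) (auto simp: pq_outside)
  also have "sum ?g {-L..-1} = sum (\<lambda>r. ?g (- 1 - r)) {0..L - 1}"
    by (rule sum.reindex_bij_witness[of _ "\<lambda>r. -1 - r" "\<lambda>r. -1 - r"]) auto
  also have "\<dots> = - sum ?g {0..L - 1}"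
    by (simp only: anti sum_negf)
  finally show ?thesis by simp
qed

text \<open>Multiply \<open>pq_step\<close> at \<open>j = 2r\<close> by
  \<open>(-1)^r q^(3r^2+r)\<close> and sum. The even kernels give \<open>beta_sum n\<close> with
  weights \<open>1\<close> and \<open>-q^n\<close>; of the two odd sums, one is the claimed one and
  the other vanishes by \<open>odd_theta_zero\<close>.\<close>

lemma beta_sum_odd:
  assumes L: "L > int n"
  shows "(\<Sum>r=-L..L. (-1) powi r * q powi (3 * r\<^sup>2 + r) * pq (int n) (2 * r + 1)) =
    (1 - q ^ n) * beta_sum n"
proof -
  let ?s = "\<lambda>r::int. (-1 :: 'a) powi r"
  have A: "beta_sum n = (\<Sum>r=-L..L. ?s r * q powi (3 * r\<^sup>2 - r) * pq (int n) (2 * r))"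
    using L by (intro beta_sum_eq) auto
  \<comment> \<open>Reflecting \<open>r\<close> swaps the exponents \<open>3r^2 - r\<close> and
    \<open>3r^2 + r\<close>, so either form represents \<open>beta_sum n\<close>.\<close>
  have A': "beta_sum n = (\<Sum>r=-L..L. ?s r * q powi (3 * r\<^sup>2 + r) * pq (int n) (2 * r))"
    unfolding A by (subst sum_int_reflect) (use pq_minus[of _ "2 * _"] in \<open>simp add: minus_one_powi_minus\<close>)
  have "?s r * q powi (3 * r\<^sup>2 + r) * pq (int n) (2 * r) - q ^ n * (?s r * q powi (3 * r\<^sup>2 - r) * pq (int n) (2 * r))
     = ?s r * q powi (3 * r\<^sup>2 + r) * pq (int n) (2 * r + 1) -
       q ^ Suc n * (?s r * q powi (3 * r\<^sup>2 + 3 * r) * pq (int n) (2 * r + 1))" for r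
  proof -
    have 1: "q ^ n * q powi (3 * r\<^sup>2 - r) = q powi (3 * r\<^sup>2 + r) * q powi (int n - 2 * r)"
      using q_nz by (simp only: power_int_of_nat[symmetric] power_int_add[symmetric] simp_thms)
         (simp add: algebra_simps)
    have 2: "q ^ Suc n * q powi (3 * r\<^sup>2 + 3 * r) = q powi (3 * r\<^sup>2 + r) * q powi (int n + 2 * r + 1)"
      using q_nz by (simp only: power_int_of_nat[symmetric] power_int_add[symmetric] simp_thms)
         (simp add: algebra_simps)
    have "?s r * q powi (3 * r\<^sup>2 + r) * ((1 - q powi (int n - 2 * r)) * pq (int n) (2 * r))
       = ?s r * q powi (3 * r\<^sup>2 + r) * ((1 - q powi (int n + 2 * r + 1)) * pq (int n) (2 * r + 1))"
      by (simp only: pq_step)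
    then have "?s r * q powi (3 * r\<^sup>2 + r) * pq (int n) (2 * r)
        - ?s r * pq (int n) (2 * r) * (q powi (3 * r\<^sup>2 + r) * q powi (int n - 2 * r))
       = ?s r * q powi (3 * r\<^sup>2 + r) * pq (int n) (2 * r + 1)
        - ?s r * pq (int n) (2 * r + 1) * (q powi (3 * r\<^sup>2 + r) * q powi (int n + 2 * r + 1))"
      by (simp only: left_diff_distrib right_diff_distrib mult_1_left mult_ac)
    then show ?thesis unfolding 1[symmetric] 2[symmetric] by (simp only: mult_ac)
  qed
  then have "beta_sum n - q ^ n * beta_sum n =
     (\<Sum>r=-L..L. ?s r * q powi (3 * r\<^sup>2 + r) * pq (int n) (2 * r + 1)) -
     q ^ Suc n * (\<Sum>r=-L..L. ?s r * q powi (3 * r\<^sup>2 + 3 * r) * pq (int n) (2 * r + 1))"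
    by (subst A', subst A) (simp only: sum_distrib_left sum_subtractf[symmetric])
  then show ?thesis
    by (simp only: odd_theta_zero[OF L]) (simp add: algebra_simps)
qed

text \<open>\<open>pq_rec\<close> at \<open>j = 2r\<close> brings in the odd neighbours
  \<open>2r - 1\<close> and \<open>2r + 1\<close>. The sum over the former is, after reflection, the
  vanishing one of \<open>odd_theta_zero\<close>; the latter is evaluated by
  \<open>beta_sum_odd\<close>.\<close>

lemma beta_sum_rec:
  "(1 - q ^ (2 * Suc n)) * (1 - q ^ (2 * n + 1)) * beta_sum (Suc n) = (1 + q ^ Suc n) * beta_sum n"
proof -
  \<comment> \<open>One range for all sums: \<open>beta_sum (Suc n)\<close> fits into it, and the
    vanishing odd sums ask for \<open>L > n\<close>.\<close>
  define L where "L = int n + 1"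
  define N where "N = int (Suc n)"
  have N: "N - 1 = int n" by (simp add: N_def)
  have L: "L > int n" "L \<ge> N" by (simp_all add: L_def N_def)
  let ?s = "\<lambda>r::int. (-1 :: 'a) powi r"
  have pw: "q powi (2 * N) = q ^ (2 * Suc n)" "q powi (2 * N - 1) = q ^ (2 * n + 1)"
    by (simp_all only: power_int_of_nat[symmetric]) (simp_all add: N_def algebra_simps)
  have "(1 - q powi (2 * N)) * (1 - q powi (2 * N - 1)) * beta_sum (Suc n) =
     (\<Sum>r=-L..L. ?s r * q powi (3 * r\<^sup>2 - r) * ((1 - q powi (2 * N)) * (1 - q powi (2 * N - 1)) * pq N (2 * r)))"
    using L beta_sum_eq[of "Suc n" L] unfolding N_def by (simp only: sum_distrib_left mult_ac)
  also have "\<dots> = (\<Sum>r=-L..L. q ^ Suc n * (?s r * q powi (3 * r\<^sup>2 - 3 * r) * pq (int n) (2 * r - 1))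
     + (1 + q ^ (2 * n + 1)) * (?s r * q powi (3 * r\<^sup>2 - r) * pq (int n) (2 * r))
     + q ^ Suc n * (?s r * q powi (3 * r\<^sup>2 + r) * pq (int n) (2 * r + 1)))"
  proof (intro sum.cong refl)
    fix r
    have 1: "q ^ Suc n * q powi (3 * r\<^sup>2 - 3 * r) = q powi (3 * r\<^sup>2 - r) * q powi (N - 2 * r)"
      using q_nz by (simp only: power_int_of_nat[symmetric] power_int_add[symmetric] simp_thms)
         (simp add: N_def algebra_simps)
    have 2: "q ^ Suc n * q powi (3 * r\<^sup>2 + r) = q powi (3 * r\<^sup>2 - r) * q powi (N + 2 * r)"
      using q_nz by (simp only: power_int_of_nat[symmetric] power_int_add[symmetric] simp_thms)
         (simp add: N_def algebra_simps)
    have P: "(1 - q powi (2 * N)) * (1 - q powi (2 * N - 1)) * pq N (2 * r) =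
        q powi (N - 2 * r) * pq (int n) (2 * r - 1) + (1 + q ^ (2 * n + 1)) * pq (int n) (2 * r)
        + q powi (N + 2 * r) * pq (int n) (2 * r + 1)"
      by (simp only: N pw pq_rec[of N "2 * r", unfolded N pw])
    have "?s r * q powi (3 * r\<^sup>2 - r) * ((1 - q powi (2 * N)) * (1 - q powi (2 * N - 1)) * pq N (2 * r))
      = ?s r * pq (int n) (2 * r - 1) * (q powi (3 * r\<^sup>2 - r) * q powi (N - 2 * r))
       + (1 + q ^ (2 * n + 1)) * (?s r * q powi (3 * r\<^sup>2 - r) * pq (int n) (2 * r))
       + ?s r * pq (int n) (2 * r + 1) * (q powi (3 * r\<^sup>2 - r) * q powi (N + 2 * r))"
      unfolding P by (simp only: distrib_left distrib_right mult_1_left mult_ac)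
    then show "?s r * q powi (3 * r\<^sup>2 - r) * ((1 - q powi (2 * N)) * (1 - q powi (2 * N - 1)) * pq N (2 * r))
      = q ^ Suc n * (?s r * q powi (3 * r\<^sup>2 - 3 * r) * pq (int n) (2 * r - 1))
     + (1 + q ^ (2 * n + 1)) * (?s r * q powi (3 * r\<^sup>2 - r) * pq (int n) (2 * r))
     + q ^ Suc n * (?s r * q powi (3 * r\<^sup>2 + r) * pq (int n) (2 * r + 1))"
      unfolding 1[symmetric] 2[symmetric] by (simp only: mult_ac)
  qed
  also have "\<dots> = q ^ Suc n * (\<Sum>r=-L..L. ?s r * q powi (3 * r\<^sup>2 - 3 * r) * pq (int n) (2 * r - 1))
     + (1 + q ^ (2 * n + 1)) * beta_sum n + q ^ Suc n * ((1 - q ^ n) * beta_sum n)"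
    by (subst beta_sum_odd[OF L(1), symmetric])
      (simp only: sum.distrib sum_distrib_left beta_sum_eq[OF less_imp_le[OF L(1)]])
  also have "(\<Sum>r=-L..L. ?s r * q powi (3 * r\<^sup>2 - 3 * r) * pq (int n) (2 * r - 1)) =
     (\<Sum>r=-L..L. ?s r * q powi (3 * r\<^sup>2 + 3 * r) * pq (int n) (2 * r + 1))"
  proof (subst sum_int_reflect, intro sum.cong refl)
    fix r
    show "?s (- r) * q powi (3 * (- r)\<^sup>2 - 3 * - r) * pq (int n) (2 * - r - 1) =
       ?s r * q powi (3 * r\<^sup>2 + 3 * r) * pq (int n) (2 * r + 1)"
      using pq_minus[of "int n" "2 * r + 1"] by (simp add: minus_one_powi_minus)
  qed
  also have "\<dots> = 0" by (rule odd_theta_zero[OF L(1)])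
  also have "q ^ Suc n * 0 + (1 + q ^ (2 * n + 1)) * beta_sum n + q ^ Suc n * ((1 - q ^ n) * beta_sum n)
      = (1 + q ^ Suc n) * beta_sum n"
  proof -
    have "q ^ (2 * n + 1) = q ^ Suc n * q ^ n" by (simp add: power_add[symmetric] mult_2)
    show ?thesis unfolding \<open>q ^ (2 * n + 1) = q ^ Suc n * q ^ n\<close> by (simp add: algebra_simps)
  qed
  finally show ?thesis unfolding pw .
qed

text \<open>Both sides are 1 at \<open>n = 0\<close> and obey \<open>beta_sum_rec\<close>; the
  quotient \<open>qf (q^2) n / qf q n\<close> is the product \<open>(-q;q)_n\<close>.\<close>

lemma beta_sum_closed: "beta_sum n = qf (q\<^sup>2) n / (qf q n * qf q (2 * n))"
proof (induction n)
  case 0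
  show ?case by (simp add: beta_sum_def pq_def iqf_def)
next
  case (Suc n)
  define a where "a = q ^ Suc n"
  define b where "b = 1 - q ^ (2 * n + 1)"
  have a2: "q ^ (2 * Suc n) = a\<^sup>2" "(q\<^sup>2) ^ Suc n = a\<^sup>2"
    unfolding a_def by (simp_all only: power_mult[symmetric] mult.commute)
  have b0: "b \<noteq> 0" using not_root[of "2 * n + 1"] by (auto simp: b_def)
  have a0: "1 - a\<^sup>2 \<noteq> 0" using not_root[of "2 * Suc n"] unfolding a2[symmetric] by auto
  have a1: "1 - a \<noteq> 0" using not_root[of "Suc n"] unfolding a_def by auto
  have rec: "(1 - a\<^sup>2) * b * beta_sum (Suc n) = (1 + a) * beta_sum n"
    using beta_sum_rec[of n] unfolding a2 a_def[symmetric] b_def .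
  have q2: "qf q (2 * Suc n) = qf q (2 * n) * b * (1 - a\<^sup>2)"
    using a2(1) by (simp add: qf_Suc b_def)
  have "beta_sum (Suc n) = (1 + a) * beta_sum n / ((1 - a\<^sup>2) * b)"
    using rec a0 b0 by (simp add: field_simps)
  also have "\<dots> = qf (q\<^sup>2) (Suc n) / (qf q (Suc n) * qf q (2 * Suc n))"
    unfolding Suc.IH q2 qf_Suc a2 a_def[symmetric]
    using a0 a1 b0 by (simp add: divide_simps) (simp add: power2_eq_square algebra_simps)
  finally show ?case .
qed


section \<open>A WZ proof of a finite Lambert series identity\<close>

definition wq :: "nat \<Rightarrow> 'a" where "wq n = oddf q n / qf (q\<^sup>2) n"

text \<open>In base \<open>q^2\<close> and multiplied by \<open>q\<close>, this is the odd part of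
  \<open>x / (1 - x)^2\<close> at \<open>x = q^(2k+1)\<close>, which is how it enters
  \<open>lambert_odd_part\<close>.\<close>

definition tq :: "nat \<Rightarrow> 'a" where "tq k = q ^ k * (1 + q ^ (2 * k + 1)) / (1 - q ^ (2 * k + 1))\<^sup>2"

lemma wq_Suc: "wq (Suc n) = wq n * (1 - q ^ (2 * n + 1)) / (1 - q ^ (2 * n + 2))"
proof -
  have "(q\<^sup>2) ^ Suc n = q ^ (2 * n + 2)"
    unfolding power_mult[symmetric] by (rule arg_cong[where f = "power q"]) simp
  then show ?thesis by (simp add: wq_def oddf_Suc qf_Suc del: power_Suc)
qed

lemma one_minus_nz: "n > 0 \<Longrightarrow> 1 - q ^ n \<noteq> 0"
  using not_root[of n] by auto

text \<open>\<open>G\<close> is the WZ mate of the normalised summand of \<open>lambert_sum\<close> below.\<close>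

lemma wz_sum:
  defines "G \<equiv> \<lambda>N k. q ^ (2 * N) * (1 - q ^ (4 * N + 1)) / ((1 - q ^ (2 * N)) * (1 - q ^ (2 * N + 1))) *
     (q ^ k - inverse (q ^ k)) * (wq (N + k) * wq (N - k))"
  assumes "N > 0" "K \<le> N"
  shows "(\<Sum>k<K. (1 - q ^ (2 * N + 1))\<^sup>2 * (tq k * wq (N + k + 1) * wq (N - k))
     - (1 - q ^ (2 * N))\<^sup>2 * (tq k * wq (N + k) * wq (N - k - 1))) = G N K"
  using \<open>K \<le> N\<close>
proof (induction K)
  case 0
  show ?case by (simp add: G_def)
next
  case (Suc k)
  then have k: "k < N" by simp
  define Y where "Y = q ^ (2 * N)"
  define p where "p = q ^ k"
  define x where "x = q ^ (2 * k + 1)"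
  have x: "x = q * p\<^sup>2" by (simp add: x_def p_def power_mult[symmetric] mult.commute)
  have p: "p \<noteq> 0" "q * p = q ^ Suc k" using q_nz by (simp_all add: p_def)
  have Y1: "q * Y = q ^ (2 * N + 1)" by (simp add: Y_def)
  have Y2: "q * Y\<^sup>2 = q ^ (4 * N + 1)" by (simp add: Y_def power_mult[symmetric] mult.commute)
  have Yx: "Y * x = q ^ (2 * (N + k) + 1)" "q * Y * x = q ^ (2 * (N + k) + 2)"
    by (simp_all add: Y_def x_def power_add[symmetric] algebra_simps)
  \<comment> \<open>These two bring \<open>wq_Suc\<close> at \<open>N - k - 1\<close> into the shape
    \<open>V\<close> of \<open>wz_step\<close>; the subtraction is genuine because
    \<open>k < N\<close>.\<close>
  have Yx': "q * Y = x * q ^ (2 * (N - k - 1) + 2)"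
    unfolding Y1 x_def power_add[symmetric] using k by (intro arg_cong[where f = "power q"]) simp
  have Yx'': "Y = x * q ^ (2 * (N - k - 1) + 1)"
    unfolding Y_def x_def power_add[symmetric] using k by (intro arg_cong[where f = "power q"]) simp
  have x0: "x \<noteq> 0" using q_nz by (simp add: x_def)
  have W: "wq (N + k + 1) = wq (N + k) * (1 - Y * x) / (1 - q * Y * x)"
    using wq_Suc[of "N + k"] unfolding Yx by simp
  have e: "N - k = Suc (N - k - 1)" using k by simp
  have V: "wq (N - k) = wq (N - k - 1) * (1 - Y / x) / (1 - q * Y / x)"
    using wq_Suc[of "N - k - 1"] x0 unfolding Yx' by (subst e, subst Yx'') simp
  have nz: "1 - x \<noteq> 0" "1 - q * Y * x \<noteq> 0" "1 - Y \<noteq> 0" "1 - q * Y \<noteq> 0"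
    unfolding Yx unfolding Y1 unfolding x_def Y_def by (rule one_minus_nz, use \<open>N > 0\<close> in simp)+
  have "1 - q ^ (2 * (N - k - 1) + 2) \<noteq> 0" by (rule one_minus_nz) simp
  moreover have "x - q * Y = x * (1 - q ^ (2 * (N - k - 1) + 2))"
    unfolding Yx' by (simp only: right_diff_distrib mult_1_right)
  ultimately have nz': "x - q * Y \<noteq> 0" using x0 by simp
  have "(1 - q * Y)\<^sup>2 * (p * (1 + x) / (1 - x)\<^sup>2 * wq (N + k + 1) * wq (N - k))
       - (1 - Y)\<^sup>2 * (p * (1 + x) / (1 - x)\<^sup>2 * wq (N + k) * wq (N - k - 1)) =
    Y * (1 - q * Y\<^sup>2) / ((1 - Y) * (1 - q * Y)) * (q * p - inverse (q * p)) * (wq (N + k + 1) * wq (N - k - 1))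
    - Y * (1 - q * Y\<^sup>2) / ((1 - Y) * (1 - q * Y)) * (p - inverse p) * (wq (N + k) * wq (N - k))"
    by (rule wz_step[OF x0 q_nz p(1) nz(1,2) nz' nz(3,4) W V x])
  also have "\<dots> = G N (Suc k) - G N k"
    unfolding G_def Y1 Y2 p(2) by (simp add: Y_def p_def)
  finally have "(1 - q ^ (2 * N + 1))\<^sup>2 * (tq k * wq (N + k + 1) * wq (N - k))
     - (1 - q ^ (2 * N))\<^sup>2 * (tq k * wq (N + k) * wq (N - k - 1)) = G N (Suc k) - G N k"
    unfolding Y1 by (simp only: Y_def p_def x_def tq_def)
  then show ?case using Suc by simp
qed

text \<open>Jackson's terminating \<open>\<^sub>8\<phi>\<^sub>7\<close> sum in base \<open>q\<^sup>2\<close> with \<open>a = q\<^sup>2\<close> and \<open>b = c = d = q\<close>.\<close>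

lemma lambert_sum:
  "(\<Sum>k\<le>N. tq k * wq (N + k + 1) * wq (N - k)) * (wq N)\<^sup>2 * (1 - q ^ (2 * N + 1))\<^sup>2 = 1"
proof (induction N)
  case 0
  have "1 - q \<noteq> 0" "1 - q\<^sup>2 \<noteq> 0" using one_minus_nz[of 1] one_minus_nz[of 2] by simp_all
  moreover have "wq 0 = 1" "wq (Suc 0) = (1 - q) / (1 - q\<^sup>2)" "tq 0 = (1 + q) / (1 - q)\<^sup>2"
    using wq_Suc[of 0] by (simp_all add: wq_def tq_def power2_eq_square)
  moreover have "1 - q\<^sup>2 = (1 + q) * (1 - q)" by (simp add: power2_eq_square algebra_simps)
  ultimately show ?case by (simp)
next
  case (Suc n)
  define N where "N = Suc n"
  define Y where "Y = q ^ (2 * N)"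
  define p where "p = q ^ N"
  have p: "Y = p\<^sup>2" "p \<noteq> 0" using q_nz by (simp_all add: Y_def p_def power_mult[symmetric] mult.commute)
  have Y1: "q ^ (2 * N + 1) = q * Y" by (simp add: Y_def)
  have Y2: "q ^ (4 * N + 1) = q * Y\<^sup>2" by (simp add: Y_def power_mult[symmetric] mult.commute)
  have Y3: "q ^ (4 * N + 2) = q\<^sup>2 * Y\<^sup>2"
    unfolding Y_def power_mult[symmetric] power_add[symmetric] by (rule arg_cong[where f = "power q"]) simp
  have nz: "1 - Y \<noteq> 0" "1 - q * Y \<noteq> 0" "1 - q\<^sup>2 * Y\<^sup>2 \<noteq> 0"
    unfolding Y1[symmetric] Y3[symmetric] unfolding Y_def by (rule one_minus_nz, simp add: N_def)+
  define R where "R = (\<Sum>k\<le>N. tq k * wq (N + k + 1) * wq (N - k))"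
  define R' where "R' = (\<Sum>k\<le>n. tq k * wq (n + k + 1) * wq (n - k))"
  \<comment> \<open>\<open>wz_sum\<close> covers only \<open>k < N\<close>. The summand
    \<open>k = N\<close> cancels the value of the mate at \<open>K = N\<close>, which leaves
    \<open>(1 - q Y)^2 R = (1 - Y)^2 R'\<close>.\<close>
  have "(1 - q * Y)\<^sup>2 * R = (1 - q * Y)\<^sup>2 * (\<Sum>k<N. tq k * wq (N + k + 1) * wq (N - k))
    + (1 - q * Y)\<^sup>2 * (tq N * wq (2 * N + 1))"
    unfolding R_def lessThan_Suc_atMost[symmetric] by (simp add: algebra_simps mult_2 mult_2_right wq_def[of 0])
  also have "(1 - q * Y)\<^sup>2 * (\<Sum>k<N. tq k * wq (N + k + 1) * wq (N - k)) = (1 - Y)\<^sup>2 * R' +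
     Y * (1 - q * Y\<^sup>2) / ((1 - Y) * (1 - q * Y)) * (p - inverse p) * wq (2 * N)"
  proof -
    have "R' = (\<Sum>k<N. tq k * wq (N + k) * wq (N - k - 1))"
      unfolding R'_def N_def lessThan_Suc_atMost by simp
    moreover have "wq (N + N) * wq (N - N) = wq (2 * N)" by (simp add: mult_2 wq_def[of 0])
    moreover have "N > 0" by (simp add: N_def)
    ultimately show ?thesis
      using wz_sum[of N N, unfolded Y1 Y2 Y_def[symmetric] p_def[symmetric] sum_subtractf sum_distrib_left[symmetric]]
      by (simp only: diff_eq_eq order_refl add.commute)
  qed
  also have "(1 - q * Y)\<^sup>2 * (tq N * wq (2 * N + 1)) = - (Y * (1 - q * Y\<^sup>2) / ((1 - Y) * (1 - q * Y)) * (p - inverse p) * wq (2 * N))"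
  proof -
    have e: "2 * (2 * N) + 1 = 4 * N + 1" "2 * (2 * N) + 2 = 4 * N + 2" by simp_all
    have "wq (2 * N + 1) = wq (2 * N) * (1 - q * Y\<^sup>2) / (1 - q\<^sup>2 * Y\<^sup>2)"
      using wq_Suc[of "2 * N"] unfolding e Y2 Y3 by simp
    moreover have "1 - q\<^sup>2 * Y\<^sup>2 = (1 - q * Y) * (1 + q * Y)"
      by (simp add: power2_eq_square algebra_simps)
    moreover from this have "1 + q * Y \<noteq> 0" using nz by auto
    moreover have "Y * (p - inverse p) = - p * (1 - Y)"
      unfolding p using p(2) by (simp add: power2_eq_square field_simps)
    moreover have "X\<^sup>2 * (p * U / X\<^sup>2 * (w * Z / (X * U))) = - (Y * Z / (M * X) * I * w)"
      if "Y * I = - p * M" "U \<noteq> 0" "X \<noteq> 0" "M \<noteq> 0" for X U w Z M I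
    proof -
      have "Y * Z / (M * X) * I * w = (Y * I) * (Z * w) / (M * X)" by simp
      then show ?thesis using that by simp
    qed
    ultimately show ?thesis using nz(1,2)
      unfolding tq_def Y1 p_def[symmetric] by (simp only: not_False_eq_True)
  qed
  finally have "(1 - q * Y)\<^sup>2 * R = (1 - Y)\<^sup>2 * R'" by simp
  moreover have "wq N * (1 - Y) = wq n * (1 - q ^ (2 * n + 1))"
    using wq_Suc[of n] nz(1) by (simp add: N_def Y_def)
  ultimately have "R * (wq N)\<^sup>2 * (1 - q * Y)\<^sup>2 = R' * (wq n * (1 - q ^ (2 * n + 1)))\<^sup>2"
    by (metis (no_types, lifting) mult.assoc mult.commute power_mult_distrib)
  then show ?case using Suc.IH unfolding R_def R'_def N_def[symmetric] Y1
    by (simp add: power_mult_distrib mult.assoc)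
qed


section \<open>A finite form of Jacobi's formula for the cube\<close>

definition tri :: "nat \<Rightarrow> 'a" where "tri k = (-1) ^ k * q ^ (k * (k + 1) div 2)"

lemma tri_Suc: "q ^ (k + 1) * tri k = - tri (Suc k)"
proof -
  have "Suc k * (Suc k + 1) div 2 = k * (k + 1) div 2 + (k + 1)"
    by simp
  then show ?thesis by (simp only: tri_def power_add power_Suc) simp
qed

text \<open>Up to the factor \<open>1 - q\<close>, the kernel of Bailey pairs relative to
  \<open>q\<close>; its centre of symmetry is -1/2.\<close>

definition cq :: "nat \<Rightarrow> int \<Rightarrow> 'a" where "cq n k = iqf (int n - k) * iqf (int n + 1 + k)"

lemma cq_sym: "cq n (-1 - k) = cq n k"
  by (simp add: cq_def algebra_simps)

lemma cq_rec:
  fixes n k :: nat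
  defines "N \<equiv> Suc n"
  shows "(1 - q ^ (2 * N)) * (1 - q ^ (2 * N + 1)) * cq N (int k) =
     q ^ N * (q ^ (k + 1) * cq n (int k + 1)) + (1 + q ^ (2 * N)) * cq n (int k)
     + q powi (int N - int k) * cq n (int k - 1)"
proof -
  define u v where "u = int N - int k" and "v = int N + 1 + int k"
  have uv: "q powi (u + v) = q ^ (2 * N + 1)" "q powi (u + v - 1) = q ^ (2 * N)"
    unfolding power_add[symmetric] power_int_of_nat[symmetric]
    by (rule arg_cong[where f = "power_int q"], simp add: u_def v_def)+
  have "v = int (N + (k + 1))" by (simp add: v_def)
  then have v: "q powi v = q ^ N * q ^ (k + 1)" by (simp only: power_int_of_nat power_add)
  have c: "iqf u * iqf v = cq N (int k)" "iqf (u - 2) * iqf v = cq n (int k + 1)"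
    "iqf (u - 1) * iqf (v - 1) = cq n (int k)" "iqf u * iqf (v - 2) = cq n (int k - 1)"
    unfolding cq_def u_def v_def N_def
    by (rule arg_cong2[where f = "\<lambda>x y. iqf x * iqf y"]; simp)+
  show ?thesis
    using iqf_rec2[of u v] unfolding uv v c u_def[symmetric] by (simp only: ac_simps)
qed

text \<open>By \<open>cq_rec\<close>, each bracket times \<open>tri k\<close> is for
  \<open>k > 0\<close> the negative second difference \<open>2 g k - g (k+1) - g (k-1)\<close>.
  Summed against the linear weight \<open>2k + 1\<close>, it leaves only boundary terms.\<close>

lemma cq_telescope:
  fixes n :: nat
  defines "N \<equiv> Suc n"
  defines "g \<equiv> \<lambda>k. q ^ N * (tri k * cq n (int k))"
  shows "(\<Sum>k\<le>K. of_nat (2 * k + 1) * (tri k * ((1 - q ^ (2 * N)) * (1 - q ^ (2 * N + 1)) * cq N (int k)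
      - (1 - q ^ N)\<^sup>2 * cq n (int k)))) = of_nat (2 * K + 3) * g K - of_nat (2 * K + 1) * g (Suc K)"
proof -
  have N2: "q ^ (2 * N) = (q ^ N)\<^sup>2" by (simp add: power_mult[symmetric] mult.commute)
  have rec: "tri k * ((1 - q ^ (2 * N)) * (1 - q ^ (2 * N + 1)) * cq N (int k) - (1 - q ^ N)\<^sup>2 * cq n (int k))
      = 2 * g k - g (Suc k) + tri k * q powi (int N - int k) * cq n (int k - 1)" for k
  proof -
    have "tri k * ((1 - q ^ (2 * N)) * (1 - q ^ (2 * N + 1)) * cq N (int k) - (1 - q ^ N)\<^sup>2 * cq n (int k))
      = 2 * g k + q ^ N * (q ^ (k + 1) * tri k) * cq n (int k + 1) + tri k * q powi (int N - int k) * cq n (int k - 1)"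
      unfolding N_def cq_rec unfolding N_def[symmetric] N2 g_def
      by (simp only: power2_diff) (simp add: algebra_simps)
    then show ?thesis unfolding tri_Suc g_def by (simp add: algebra_simps)
  qed
  show ?thesis
  proof (induction K)
    case 0
    \<comment> \<open>Here the symmetry of \<open>cq\<close> sends index -1 to 0, so the term
      \<open>k = 0\<close> is \<open>3 g 0 - g 1\<close>.\<close>
    have "tri 0 * q powi (int N - int 0) * cq n (int 0 - 1) = g 0"
      using cq_sym[of n 0] by (simp add: g_def tri_def)
    then show ?case by (simp only: atMost_0 sum.insert finite.emptyI sum.empty rec) simp
  next
    case (Suc K)
    have "tri (Suc K) * q powi (int N - int (Suc K)) * cq n (int (Suc K) - 1) = - g K"
    proof -
      have "q powi (int N - int (Suc K)) * q ^ (K + 1) = q ^ N"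
        using q_nz by (simp add: power_int_diff power_int_add del: of_nat_Suc)
      moreover have "tri (Suc K) = - (q ^ (K + 1) * tri K)" using tri_Suc[of K] by simp
      ultimately show ?thesis by (simp add: g_def algebra_simps)
    qed
    then have "(\<Sum>k\<le>Suc K. of_nat (2 * k + 1) * (tri k * ((1 - q ^ (2 * N)) * (1 - q ^ (2 * N + 1)) * cq N (int k)
      - (1 - q ^ N)\<^sup>2 * cq n (int k)))) = of_nat (2 * K + 3) * g K - of_nat (2 * K + 1) * g (Suc K)
      + of_nat (2 * Suc K + 1) * (2 * g (Suc K) - g (Suc (Suc K)) - g K)"
      by (subst sum.atMost_Suc, subst Suc.IH, subst rec) simp
    then show ?case by (simp add: algebra_simps)
  qed
qed

text \<open>Induction by \<open>cq_telescope\<close> with \<open>K = n + 1\<close>: both boundary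
  terms contain \<open>cq n k\<close> with \<open>k > n\<close> and vanish. Letting \<open>n\<close>
  grow gives Jacobi's series for the cube of \<open>E(q)\<close>.\<close>

lemma jacobi_finite:
  "(\<Sum>k\<le>n. of_nat (2 * k + 1) * (tri k * cq n (int k))) = (qf q n)\<^sup>2 / qf q (2 * n + 1)"
proof (induction n)
  case 0
  then show ?case by (simp add: tri_def cq_def iqf_def field_simps qf_def)
next
  case (Suc n)
  define N where "N = Suc n"
  let ?S = "\<lambda>N. \<Sum>k\<le>N. of_nat (2 * k + 1) * (tri k * cq N (int k))"
  have "(1 - q ^ (2 * N)) * (1 - q ^ (2 * N + 1)) * ?S N - (1 - q ^ N)\<^sup>2 * (\<Sum>k\<le>N. of_nat (2 * k + 1) * (tri k * cq n (int k))) =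
    (\<Sum>k\<le>N. of_nat (2 * k + 1) * (tri k * ((1 - q ^ (2 * N)) * (1 - q ^ (2 * N + 1)) * cq N (int k)
      - (1 - q ^ N)\<^sup>2 * cq n (int k))))"
    unfolding sum_distrib_left sum_subtractf[symmetric] by (intro sum.cong refl) (simp only: right_diff_distrib mult_ac)
  also have "\<dots> = 0"
    unfolding N_def cq_telescope by (simp add: cq_def)
  also have "(\<Sum>k\<le>N. of_nat (2 * k + 1) * (tri k * cq n (int k))) = ?S n"
    by (simp add: N_def cq_def)
  finally have rec: "(1 - q ^ (2 * N)) * (1 - q ^ (2 * N + 1)) * ?S N = (1 - q ^ N)\<^sup>2 * ((qf q n)\<^sup>2 / qf q (2 * n + 1))"
    using Suc.IH by simp
  have e: "2 * N = Suc (2 * n + 1)" by (simp add: N_def)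
  have e1: "qf q (2 * N + 1) = qf q (2 * n + 1) * (1 - q ^ (2 * N)) * (1 - q ^ (2 * N + 1))"
    using qf_Suc[of q "2 * N"] qf_Suc[of q "2 * n + 1", folded e] by simp
  have nz: "1 - q ^ (2 * N) \<noteq> 0" "1 - q ^ (2 * N + 1) \<noteq> 0"
    by (rule one_minus_nz, simp add: N_def)+
  have e2: "qf q N = qf q n * (1 - q ^ N)" by (simp add: N_def qf_Suc)
  have "S = A\<^sup>2 / B" if "X * Y * S = Z\<^sup>2 * (C\<^sup>2 / D)" "B = D * X * Y" "X \<noteq> 0" "Y \<noteq> 0" "A = C * Z" "D \<noteq> 0"
    for S X Y Z A B C D :: 'a
    using that by (simp add: field_simps)
  from this[OF rec e1 nz e2 qf_nz] show ?case unfolding N_def .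
qed

section \<open>Bailey's lemma applied to the pair\<close>

lemma sum_int_fold:
  fixes g :: "int \<Rightarrow> 'b::comm_monoid_add"
  shows "(\<Sum>r=-int N..int N. g r) = g 0 + (\<Sum>r=1..N. g (int r) + g (- int r))"
proof (induction N)
  case (Suc N)
  have "{-int (Suc N)..int (Suc N)} = insert (int (Suc N)) (insert (- int (Suc N)) {-int N..int N})"
    by auto
  then show ?case using Suc by (simp add: ac_simps)
qed simp

lemma beta_sum_fold:
  assumes "n \<le> N"
  shows "beta_sum n = pq (int n) 0 +
    (\<Sum>r=1..N. (-1) ^ r * (q ^ (3 * r\<^sup>2 - r) + q ^ (3 * r\<^sup>2 + r)) * pq (int n) (int (2 * r)))"
proof -
  define g where "g = (\<lambda>r. (-1) powi r * q powi (3 * r\<^sup>2 - r) * pq (int n) (2 * r))"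
  have "beta_sum n = (\<Sum>r=-int N..int N. g r)"
    unfolding g_def by (rule beta_sum_eq) (use assms in simp)
  also have "\<dots> = g 0 + (\<Sum>r=1..N. g (int r) + g (- int r))"
    by (rule sum_int_fold)
  also have "g 0 = pq (int n) 0" by (simp add: g_def)
  finally have *: "beta_sum n = pq (int n) 0 + (\<Sum>r=1..N. g (int r) + g (- int r))" .
  have **: "g (int r) + g (- int r) = (-1) ^ r * (q ^ (3 * r\<^sup>2 - r) + q ^ (3 * r\<^sup>2 + r)) * pq (int n) (int (2 * r))" for r
  proof -
    have "r \<le> 3 * r\<^sup>2" by (cases r) (auto simp: power2_eq_square)
    then have e: "3 * (int r)\<^sup>2 - int r = int (3 * r\<^sup>2 - r)" "3 * (- int r)\<^sup>2 - - int r = int (3 * r\<^sup>2 + r)"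
      by (simp_all add: of_nat_diff)
    have p: "pq (int n) (2 * - int r) = pq (int n) (int (2 * r))"
      using pq_minus[of "int n" "int (2 * r)"] by simp
    have "2 * int r = int (2 * r)" by simp
    then show ?thesis unfolding g_def e p minus_one_powi_minus power_int_of_nat by (simp only: distrib_left distrib_right mult_ac)
  qed
  show ?thesis unfolding * ** ..
qed

text \<open>Expand \<open>beta_sum n\<close> in kernels and swap the sums. Index 0 lies outside
  \<open>bailey_sum\<close> and contributes \<open>q^n / (1 - q^n)^2\<close> directly; index
  \<open>2r\<close> is summed by \<open>bailey_sum\<close> and leaves a quotient of q-factorials
  that tends to 1.\<close>

lemma bailey_closed:
  "(\<Sum>n=1..N. q ^ n * (qf q (n - 1))\<^sup>2 * (qf (q\<^sup>2) n / (qf q n * qf q (2 * n)))) =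
   (\<Sum>n=1..N. q ^ n / (1 - q ^ n)\<^sup>2) +
   (\<Sum>r=1..N div 2. (-1) ^ r * (q ^ (3 * r\<^sup>2 - r) + q ^ (3 * r\<^sup>2 + r)) *
      (q ^ (2 * r) / (1 - q ^ (2 * r))\<^sup>2 * ((qf q N)\<^sup>2 / (qf q (N - 2 * r) * qf q (N + 2 * r)))))"
proof -
  define a where "a = (\<lambda>r. (-1) ^ r * (q ^ (3 * r\<^sup>2 - r) + q ^ (3 * r\<^sup>2 + r)))"
  define c where "c = (\<lambda>n. q ^ n * (qf q (n - 1))\<^sup>2)"
  have c0: "c n * pq (int n) 0 = q ^ n / (1 - q ^ n)\<^sup>2" if "n \<in> {1..N}" for n
  proof -
    have "qf q n = qf q (n - 1) * (1 - q ^ n)"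
      using qf_Suc[of q "n - 1"] that by (simp del: power_Suc)
    then show ?thesis by (simp add: c_def pq_def iqf_nat power2_eq_square divide_simps)
  qed
  have "(\<Sum>n=1..N. c n * (qf (q\<^sup>2) n / (qf q n * qf q (2 * n)))) = (\<Sum>n=1..N. c n * beta_sum n)"
    unfolding beta_sum_closed ..
  also have "\<dots> = (\<Sum>n=1..N. q ^ n / (1 - q ^ n)\<^sup>2 + (\<Sum>r=1..N. c n * (a r * pq (int n) (int (2 * r)))))"
  proof (rule sum.cong[OF refl])
    fix n assume n: "n \<in> {1..N}"
    then have "n \<le> N" by simp
    show "c n * beta_sum n = q ^ n / (1 - q ^ n)\<^sup>2 + (\<Sum>r=1..N. c n * (a r * pq (int n) (int (2 * r))))"
      unfolding beta_sum_fold[OF \<open>n \<le> N\<close>] distrib_left c0[OF n] sum_distrib_left a_def ..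
  qed
  also have "\<dots> = (\<Sum>n=1..N. q ^ n / (1 - q ^ n)\<^sup>2) + (\<Sum>r=1..N. \<Sum>n=1..N. c n * (a r * pq (int n) (int (2 * r))))"
    unfolding sum.distrib by (subst (2) sum.swap) (rule refl)
  also have "(\<Sum>r=1..N. \<Sum>n=1..N. c n * (a r * pq (int n) (int (2 * r)))) =
     (\<Sum>r=1..N. a r * (q ^ (2 * r) / (1 - q ^ (2 * r))\<^sup>2 * (qf q N)\<^sup>2 * pq (int N) (int (2 * r))))"
  proof (rule sum.cong[OF refl])
    fix r assume "r \<in> {1..N}"
    then have "2 * r > 0" by simp
    then have "(\<Sum>n=1..N. c n * pq (int n) (int (2 * r))) = q ^ (2 * r) / (1 - q ^ (2 * r))\<^sup>2 * (qf q N)\<^sup>2 * pq (int N) (int (2 * r))"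
      unfolding c_def by (rule bailey_sum)
    then show "(\<Sum>n=1..N. c n * (a r * pq (int n) (int (2 * r)))) =
      a r * (q ^ (2 * r) / (1 - q ^ (2 * r))\<^sup>2 * (qf q N)\<^sup>2 * pq (int N) (int (2 * r)))"
      by (simp only: mult.left_commute[of _ "a r"] sum_distrib_left[symmetric])
  qed
  \<comment> \<open>The kernel vanishes for \<open>2r > N\<close>; the cut makes
    \<open>N - 2 * r\<close> a true difference.\<close>
  also have "\<dots> = (\<Sum>r=1..N div 2. a r * (q ^ (2 * r) / (1 - q ^ (2 * r))\<^sup>2 * (qf q N)\<^sup>2 * pq (int N) (int (2 * r))))"
    by (intro sum.mono_neutral_right) (auto simp: pq_outside)
  also have "\<dots> = (\<Sum>r=1..N div 2. a r * (q ^ (2 * r) / (1 - q ^ (2 * r))\<^sup>2 * ((qf q N)\<^sup>2 / (qf q (N - 2 * r) * qf q (N + 2 * r)))))"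
  proof (rule sum.cong[OF refl])
    fix r assume "r \<in> {1..N div 2}"
    then have r: "2 * r \<le> N" by auto
    have "pq (int N) (int (2 * r)) = inverse (qf q (N - 2 * r)) * inverse (qf q (N + 2 * r))"
      unfolding pq_def of_nat_diff[OF r, symmetric] of_nat_add[symmetric] iqf_nat ..
    then show "a r * (q ^ (2 * r) / (1 - q ^ (2 * r))\<^sup>2 * (qf q N)\<^sup>2 * pq (int N) (int (2 * r))) =
      a r * (q ^ (2 * r) / (1 - q ^ (2 * r))\<^sup>2 * ((qf q N)\<^sup>2 / (qf q (N - 2 * r) * qf q (N + 2 * r))))"
      by (simp add: divide_inverse)
  qed
  finally show ?thesis unfolding a_def c_def .
qed

end

section \<open>Partitions and their generating function\<close>

definition parts_in :: "nat set \<Rightarrow> nat \<Rightarrow> nat multiset set" where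
  "parts_in A s = {p. set_mset p \<subseteq> A \<and> sum_mset p = s}"

lemma finite_parts_in:
  assumes "finite A" "0 \<notin> A"
  shows "finite (parts_in A s)"
proof -
  have size_le: "(\<forall>k \<in># p. 0 < k) \<Longrightarrow> size p \<le> sum_mset p" for p :: "nat multiset"
    by (induction p) auto
  have "parts_in A s \<subseteq> mset ` {xs. set xs \<subseteq> A \<and> length xs \<le> s}"
  proof
    fix p assume p: "p \<in> parts_in A s"
    obtain xs where xs: "mset xs = p" using ex_mset by blast
    have "\<forall>k \<in># p. 0 < k" using p assms(2) by (auto simp: parts_in_def intro!: Nat.gr0I)
    then have "size p \<le> s" using size_le p by (auto simp: parts_in_def)
    then have "set xs \<subseteq> A \<and> length xs \<le> s" using p xs by (auto simp: parts_in_def)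
    then show "p \<in> mset ` {xs. set xs \<subseteq> A \<and> length xs \<le> s}" using xs by blast
  qed
  then show ?thesis by (rule finite_subset) (simp add: finite_lists_length_le assms)
qed

text \<open>A multiset either avoids \<open>a\<close> or arises by adding one copy of
  \<open>a\<close>: the combinatorial form of the factor \<open>1 / (1 - X^a)\<close>.\<close>

lemma parts_in_insert:
  assumes a: "a \<notin> A"
  shows "parts_in (insert a A) s = parts_in A s \<union> (if a \<le> s then add_mset a ` parts_in (insert a A) (s - a) else {})"
    and "parts_in A s \<inter> add_mset a ` parts_in (insert a A) (s - a) = {}"
proof -
  have "a \<notin># p" if "p \<in> parts_in A s" for p
    using that a unfolding parts_in_def by blast
  then show "parts_in A s \<inter> add_mset a ` parts_in (insert a A) (s - a) = {}"
    by fastforce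
  show "parts_in (insert a A) s = parts_in A s \<union> (if a \<le> s then add_mset a ` parts_in (insert a A) (s - a) else {})"
    (is "_ = ?R")
  proof (rule Set.set_eqI)
    fix p
    show "p \<in> parts_in (insert a A) s \<longleftrightarrow> p \<in> ?R"
    proof (cases "a \<in># p")
      case True
      then obtain p' where p': "p = add_mset a p'" by (metis insert_DiffM)
      have "p \<notin> parts_in A s" using True a unfolding parts_in_def by blast
      moreover have "p \<in> parts_in (insert a A) s \<longleftrightarrow> a \<le> s \<and> p' \<in> parts_in (insert a A) (s - a)"
        unfolding p' parts_in_def by auto
      moreover have "p \<in> add_mset a ` B \<longleftrightarrow> p' \<in> B" for B
        unfolding p' by auto
      ultimately show ?thesis by simp
    next
      case False
      then have "p \<notin> add_mset a ` B" for B by auto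
      then have "p \<in> ?R \<longleftrightarrow> p \<in> parts_in A s" by simp
      moreover have "p \<in> parts_in (insert a A) s \<longleftrightarrow> p \<in> parts_in A s"
        using False by (simp add: parts_in_def subset_insert)
      ultimately show ?thesis by blast
    qed
  qed
qed

lemma one_minus_X_power_nth_mult:
  fixes f :: "'a::comm_ring_1 fps"
  shows "((1 - fps_X ^ a) * f) $ s = f $ s - (if a \<le> s then f $ (s - a) else 0)"
  by (simp add: left_diff_distrib fps_X_power_mult_nth not_less)

lemma fps_inverse_unique_left:
  fixes f g h :: "'a::field fps"
  assumes "f $ 0 \<noteq> 0" "f * g = h"
  shows "g = inverse f * h"
proof -
  have "inverse f * h = (inverse f * f) * g" using assms(2) by (simp add: mult.assoc)
  then show ?thesis using assms(1) by (simp add: inverse_mult_eq_1)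
qed

lemma card_parts_in_gf:
  fixes A :: "nat set"
  assumes "finite A" "0 \<notin> A"
  shows "Abs_fps (\<lambda>s. of_nat (card (parts_in A s)) :: 'a::field) = (\<Prod>a\<in>A. inverse (1 - fps_X ^ a))"
  using assms
proof (induction A rule: finite_induct)
  case empty
  have "parts_in {} s = (if s = 0 then {{#}} else {})" for s
    by (auto simp: parts_in_def)
  then show ?case by (simp add: fps_eq_iff)
next
  case (insert a A)
  let ?F = "\<lambda>A. Abs_fps (\<lambda>s. of_nat (card (parts_in A s)) :: 'a)"
  have a: "a > 0" using insert.prems by (simp add: Nat.gr0I)
  have fin: "finite (parts_in A s)" "finite (parts_in (insert a A) s)" for s
    using insert by (auto intro!: finite_parts_in)
  have "card (parts_in (insert a A) s) = card (parts_in A s) + (if a \<le> s then card (parts_in (insert a A) (s - a)) else 0)" for s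
  proof (cases "a \<le> s")
    case True
    have "card (parts_in (insert a A) s) = card (parts_in A s \<union> add_mset a ` parts_in (insert a A) (s - a))"
      using parts_in_insert(1)[OF insert.hyps(2), of s] True by simp
    also have "\<dots> = card (parts_in A s) + card (add_mset a ` parts_in (insert a A) (s - a))"
      by (rule card_Un_disjoint) (use fin parts_in_insert(2)[OF insert.hyps(2)] in auto)
    also have "card (add_mset a ` parts_in (insert a A) (s - a)) = card (parts_in (insert a A) (s - a))"
      by (rule card_image) (simp add: inj_on_def)
    finally show ?thesis using True by simp
  next
    case False
    then show ?thesis using parts_in_insert(1)[OF insert.hyps(2), of s] by simp
  qed
  then have "(1 - fps_X ^ a) * ?F (insert a A) = ?F A"
    by (intro fps_ext) (simp add: one_minus_X_power_nth_mult)
  then have "?F (insert a A) = inverse (1 - fps_X ^ a) * ?F A"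
    using a by (intro fps_inverse_unique_left) (simp_all)
  also have "?F A = (\<Prod>b\<in>A. inverse (1 - fps_X ^ b))"
    using insert.prems by (intro insert.IH) simp
  finally show ?case by (simp only: prod.insert[OF insert.hyps])
qed

text \<open>Adding a copy of \<open>a\<close> raises the count by one, so the weighted series
  \<open>W\<close> and the plain counting series \<open>F\<close> satisfy
  \<open>(1 - X^a) W = X^a F\<close>. This is where the square of \<open>1 / (1 - X^a)\<close> comes
  from.\<close>

lemma count_parts_in_gf:
  fixes A :: "nat set"
  assumes A: "finite A" "0 \<notin> A" "a \<notin> A" "a > 0"
  shows "Abs_fps (\<lambda>s. of_nat (\<Sum>p\<in>parts_in (insert a A) s. count p a) :: 'a::field) =
    fps_X ^ a * (inverse (1 - fps_X ^ a))\<^sup>2 * (\<Prod>a\<in>A. inverse (1 - fps_X ^ a))"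
proof -
  let ?c = "\<lambda>s. \<Sum>p\<in>parts_in (insert a A) s. count p a"
  let ?W = "Abs_fps (\<lambda>s. of_nat (?c s) :: 'a)"
  let ?F = "Abs_fps (\<lambda>s. of_nat (card (parts_in (insert a A) s)) :: 'a)"
  have fin: "finite (parts_in A s)" "finite (parts_in (insert a A) s)" for s
    using A by (auto intro!: finite_parts_in)
  have z: "(\<Sum>p\<in>parts_in A s. count p a) = 0" for s
    using A(3) by (auto simp: parts_in_def count_eq_zero_iff intro!: sum.neutral)
  have rec: "?c s = (if a \<le> s then ?c (s - a) + card (parts_in (insert a A) (s - a)) else 0)" for s
  proof (cases "a \<le> s")
    case True
    have "?c s = (\<Sum>p\<in>parts_in A s \<union> add_mset a ` parts_in (insert a A) (s - a). count p a)"
      using parts_in_insert(1)[OF A(3), of s] True by simp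
    also have "\<dots> = (\<Sum>p\<in>parts_in A s. count p a) + (\<Sum>p\<in>add_mset a ` parts_in (insert a A) (s - a). count p a)"
      by (rule sum.union_disjoint) (use fin parts_in_insert(2)[OF A(3)] in auto)
    also have "(\<Sum>p\<in>add_mset a ` parts_in (insert a A) (s - a). count p a) = ?c (s - a) + card (parts_in (insert a A) (s - a))"
      by (subst sum.reindex) (simp_all add: inj_on_def sum.distrib[symmetric] sum_Suc)
    finally show ?thesis using True z by simp
  next
    case False
    then show ?thesis using parts_in_insert(1)[OF A(3), of s] z by simp
  qed
  have "(1 - fps_X ^ a) * ?W = fps_X ^ a * ?F"
  proof (rule fps_ext)
    fix s
    have "of_nat (?c s) = (if a \<le> s then of_nat (?c (s - a)) + of_nat (card (parts_in (insert a A) (s - a))) else (0::'a))"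
      by (subst rec) (simp del: of_nat_sum)
    then show "((1 - fps_X ^ a) * ?W) $ s = (fps_X ^ a * ?F) $ s"
      by (cases "a \<le> s") (simp_all only: one_minus_X_power_nth_mult fps_X_power_mult_nth fps_nth_Abs_fps not_less[symmetric] if_True if_False simp_thms not_False_eq_True add_diff_cancel_left' diff_zero)
  qed
  then have "?W = inverse (1 - fps_X ^ a) * (fps_X ^ a * ?F)"
    using A(4) by (intro fps_inverse_unique_left) simp_all
  also have "?F = inverse (1 - fps_X ^ a) * (\<Prod>a\<in>A. inverse (1 - fps_X ^ a))"
  proof -
    have "?F = (\<Prod>b\<in>insert a A. inverse (1 - fps_X ^ b))"
      by (rule card_parts_in_gf) (use A in auto)
    then show ?thesis by (simp only: prod.insert[OF A(1,3)])
  qed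
  also have "inverse (1 - fps_X ^ a) * (fps_X ^ a * (inverse (1 - fps_X ^ a) * (\<Prod>a\<in>A. inverse (1 - fps_X ^ a)))) =
      fps_X ^ a * (inverse (1 - fps_X ^ a))\<^sup>2 * (\<Prod>a\<in>A. inverse (1 - fps_X ^ a :: 'a fps))"
    by (simp only: power2_eq_square mult_ac)
  finally show ?thesis .
qed

section \<open>Partitions sorted by their smallest part\<close>

definition larger_parts :: "nat \<Rightarrow> nat \<Rightarrow> nat set" where
  "larger_parts M n = {n<..2 * n} \<union> (*) 2 ` {n<..M}"

text \<open>Parts between \<open>n\<close> and \<open>2n\<close> are unrestricted, since an odd one
  is automatically below \<open>2n\<close>; beyond that only even parts \<open>2j\<close> with
  \<open>j > n\<close> remain. Bounding \<open>j\<close> by \<open>M >= m\<close> loses nothing and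
  keeps the set of parts finite.\<close>

lemma omega_partitions_Min:
  assumes "0 < m" "m \<le> M" "0 < n"
  shows "{p \<in> omega_partitions m. Min (set_mset p) = n} = {p \<in> parts_in (insert n (larger_parts M n)) m. n \<in># p}"
proof (intro equalityI subsetI)
  fix p assume p: "p \<in> {p \<in> omega_partitions m. Min (set_mset p) = n}"
  then have s: "sum_mset p = m" and odd: "\<And>k. k \<in># p \<Longrightarrow> odd k \<Longrightarrow> k < 2 * n" and n: "n = Min (set_mset p)"
    by (auto simp: omega_partitions_def)
  have "p \<noteq> {#}" using s assms by auto
  then have np: "n \<in># p" unfolding n by (intro Min_in) auto
  have ge: "n \<le> k" if "k \<in># p" for k unfolding n using that by (intro Min_le) auto
  have "k \<in> insert n (larger_parts M n)" if k: "k \<in># p" for k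
  proof -
    have km: "k \<le> m" using sum_mset.remove[OF k] s by simp
    show ?thesis
    proof (cases "k \<le> 2 * n")
      case True
      then show ?thesis using ge[OF k] by (auto simp: larger_parts_def)
    next
      case False
      then obtain j where "k = 2 * j" using odd[OF k] by fastforce
      then show ?thesis using False km assms by (auto simp: larger_parts_def)
    qed
  qed
  then show "p \<in> {p \<in> parts_in (insert n (larger_parts M n)) m. n \<in># p}"
    using s np by (auto simp: parts_in_def)
next
  fix p assume p: "p \<in> {p \<in> parts_in (insert n (larger_parts M n)) m. n \<in># p}"
  then have s: "sum_mset p = m" and sub: "set_mset p \<subseteq> insert n (larger_parts M n)" and np: "n \<in># p"
    by (auto simp: parts_in_def)
  have ge: "n \<le> k" if "k \<in># p" for k using that sub by (auto simp: larger_parts_def)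
  have n: "Min (set_mset p) = n" by (rule Min_eqI) (use np ge in auto)
  have "k < 2 * n" if "k \<in># p" "odd k" for k
  proof -
    have "k \<in> insert n (larger_parts M n)" using that sub by blast
    then have "k \<le> 2 * n" using that assms by (auto simp: larger_parts_def)
    moreover have "k \<noteq> 2 * n" using that by auto
    ultimately show ?thesis by simp
  qed
  moreover have "0 < k" if "k \<in># p" for k using ge[OF that] assms(3) by simp
  ultimately show "p \<in> {p \<in> omega_partitions m. Min (set_mset p) = n}"
    using s n by (simp add: omega_partitions_def)
qed

lemma spt_omega_eq_sum:
  assumes "0 < m" "m \<le> M"
  shows "spt_omega m = (\<Sum>n=1..M. \<Sum>p\<in>parts_in (insert n (larger_parts M n)) m. count p n)"
proof -
  have Min_range: "Min (set_mset p) \<in> {1..M}" if p: "p \<in> omega_partitions m" for p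
  proof -
    have s: "sum_mset p = m" and pos: "\<forall>k\<in>#p. 0 < k" using p by (auto simp: omega_partitions_def)
    have "p \<noteq> {#}" using s assms by auto
    then have i: "Min (set_mset p) \<in># p" by (intro Min_in) auto
    have "Min (set_mset p) \<le> m" using sum_mset.remove[OF i] s by simp
    then show ?thesis using pos i assms by (auto simp: Suc_le_eq)
  qed
  have "spt_omega m = (\<Sum>n=1..M. \<Sum>p\<in>{p \<in> omega_partitions m. Min (set_mset p) = n}. count p (Min (set_mset p)))"
    unfolding spt_omega_def using Min_range
    by (intro sum.group[symmetric] finite_omega_partitions) auto
  also have "\<dots> = (\<Sum>n=1..M. \<Sum>p\<in>parts_in (insert n (larger_parts M n)) m. count p n)"
  proof (rule sum.cong[OF refl])
    fix n assume "n \<in> {1..M}"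
    then have n: "0 < n" by simp
    have "(\<Sum>p\<in>{p \<in> omega_partitions m. Min (set_mset p) = n}. count p (Min (set_mset p)))
      = (\<Sum>p\<in>{p \<in> omega_partitions m. Min (set_mset p) = n}. count p n)"
      by (intro sum.cong) auto
    also have "\<dots> = (\<Sum>p\<in>parts_in (insert n (larger_parts M n)) m. count p n)"
      unfolding omega_partitions_Min[OF assms n]
      by (intro sum.mono_neutral_left finite_parts_in)
        (auto simp: larger_parts_def n count_eq_zero_iff)
    finally show "(\<Sum>p\<in>{p \<in> omega_partitions m. Min (set_mset p) = n}. count p (Min (set_mset p)))
      = (\<Sum>p\<in>parts_in (insert n (larger_parts M n)) m. count p n)" .
  qed
  finally show ?thesis .
qed

text \<open>The infinite product over even parts is cut at \<open>j = M\<close>, so the claim is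
  restricted to coefficients \<open>m <= M\<close>.\<close>

lemma spt_omega_gf:
  assumes "0 < m" "m \<le> M"
  shows "(of_nat (spt_omega m) :: 'a::field) =
    (\<Sum>n=1..M. fps_X ^ n * (inverse (1 - fps_X ^ n))\<^sup>2 * ((\<Prod>i\<in>{n<..2 * n}. inverse (1 - fps_X ^ i)) *
       (\<Prod>j\<in>{n<..M}. inverse (1 - (fps_X\<^sup>2) ^ j)))) $ m"
proof -
  have "of_nat (spt_omega m) = (\<Sum>n=1..M. Abs_fps (\<lambda>s. of_nat (\<Sum>p\<in>parts_in (insert n (larger_parts M n)) s. count p n) :: 'a)) $ m"
    by (simp only: spt_omega_eq_sum[OF assms] of_nat_sum fps_sum_nth fps_nth_Abs_fps)
  also have "(\<Sum>n=1..M. Abs_fps (\<lambda>s. of_nat (\<Sum>p\<in>parts_in (insert n (larger_parts M n)) s. count p n) :: 'a)) =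
    (\<Sum>n=1..M. fps_X ^ n * (inverse (1 - fps_X ^ n))\<^sup>2 * ((\<Prod>i\<in>{n<..2 * n}. inverse (1 - fps_X ^ i)) *
       (\<Prod>j\<in>{n<..M}. inverse (1 - (fps_X\<^sup>2) ^ j))))"
  proof (intro sum.cong refl)
    fix n assume "n \<in> {1..M}"
    then have n: "finite (larger_parts M n)" "0 \<notin> larger_parts M n" "n \<notin> larger_parts M n" "n > 0"
      by (auto simp: larger_parts_def)
    have P: "(\<Prod>a\<in>larger_parts M n. inverse (1 - fps_X ^ a :: 'a fps)) =
       (\<Prod>i\<in>{n<..2 * n}. inverse (1 - fps_X ^ i)) * (\<Prod>j\<in>{n<..M}. inverse (1 - (fps_X\<^sup>2) ^ j))"
    proof -
      have "{n<..2 * n} \<inter> (*) 2 ` {n<..M} = {}" by auto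
      moreover have "(\<Prod>a\<in>(*) 2 ` {n<..M}. inverse (1 - fps_X ^ a :: 'a fps)) =
          (\<Prod>j\<in>{n<..M}. inverse (1 - (fps_X\<^sup>2) ^ j))"
        by (subst prod.reindex) (simp_all only: inj_on_def comp_def power_mult, simp)
      ultimately show ?thesis
        unfolding larger_parts_def by (subst prod.union_disjoint) simp_all
    qed
    show "Abs_fps (\<lambda>s. of_nat (\<Sum>p\<in>parts_in (insert n (larger_parts M n)) s. count p n) :: 'a) =
      fps_X ^ n * (inverse (1 - fps_X ^ n))\<^sup>2 * ((\<Prod>i\<in>{n<..2 * n}. inverse (1 - fps_X ^ i)) *
       (\<Prod>j\<in>{n<..M}. inverse (1 - (fps_X\<^sup>2) ^ j)))"
      unfolding P[symmetric] by (rule count_parts_in_gf[OF n])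
  qed
  finally show ?thesis .
qed

section \<open>Congruences modulo powers of q\<close>

definition cgr :: "'a::comm_ring_1 \<Rightarrow> 'a \<Rightarrow> 'a \<Rightarrow> bool" where
  "cgr c a b \<longleftrightarrow> c dvd a - b"

lemma cgr_refl [simp]: "cgr c a a" by (simp add: cgr_def)

lemma cgr_sym: "cgr c a b \<Longrightarrow> cgr c b a"
  unfolding cgr_def by (subst dvd_minus_iff[symmetric]) simp

lemma cgr_trans [trans]: "cgr c a b \<Longrightarrow> cgr c b d \<Longrightarrow> cgr c a d"
  unfolding cgr_def using dvd_add[of c "a - b" "b - d"] by simp

lemma cgr_add: "cgr c a b \<Longrightarrow> cgr c a' b' \<Longrightarrow> cgr c (a + a') (b + b')"
  unfolding cgr_def using dvd_add[of c "a - b" "a' - b'"] by (simp add: algebra_simps)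

lemma cgr_mult:
  assumes "cgr c a b" "cgr c a' b'" shows "cgr c (a * a') (b * b')"
proof -
  have "a * a' - b * b' = (a - b) * a' + b * (a' - b')" by (simp add: algebra_simps)
  then show ?thesis using assms unfolding cgr_def by simp
qed

lemma cgr_power: "cgr c a b \<Longrightarrow> cgr c (a ^ n) (b ^ n)"
  by (induction n) (auto intro: cgr_mult)

lemma cgr_sum: "(\<And>i. i \<in> I \<Longrightarrow> cgr c (f i) (g i)) \<Longrightarrow> cgr c (sum f I) (sum g I)"
  unfolding cgr_def sum_subtractf[symmetric] by (rule dvd_sum)

text \<open>The way precision is regained: a factor \<open>q^k\<close> compensates for a congruence
  known only modulo \<open>q^(N-k+1)\<close>.\<close>

lemma cgr_scale: "cgr c a b \<Longrightarrow> cgr (d * c) (d * a) (d * b)"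
  unfolding cgr_def right_diff_distrib[symmetric] by (rule mult_dvd_mono) auto

lemma cgr_mono: "cgr d a b \<Longrightarrow> c dvd d \<Longrightarrow> cgr c a b"
  unfolding cgr_def by (rule dvd_trans)

lemma cgr_inverse:
  fixes f g :: "'a::field fps"
  assumes "cgr c f g" "f $ 0 \<noteq> 0" "g $ 0 \<noteq> 0"
  shows "cgr c (inverse f) (inverse g)"
proof -
  have 1: "inverse f * f = 1" "inverse g * g = 1" using assms by (simp_all add: inverse_mult_eq_1)
  have "inverse f - inverse g = inverse f * (inverse g * g) - (inverse f * f) * inverse g"
    unfolding 1 by simp
  also have "\<dots> = (inverse f * inverse g) * (g - f)" by (simp only: right_diff_distrib mult_ac)
  finally show ?thesis using cgr_sym[OF assms(1)] unfolding cgr_def by simp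
qed

lemma cgr_nth:
  fixes f g :: "'a::comm_ring_1 fps"
  assumes "cgr (fps_X ^ K) f g" "m < K"
  shows "f $ m = g $ m"
proof -
  obtain h where "f - g = fps_X ^ K * h" using assms(1) unfolding cgr_def by (elim dvdE)
  then have "(f - g) $ m = 0" using assms(2) by (simp add: fps_X_power_mult_nth)
  then show ?thesis by simp
qed

text \<open>All factors beyond index \<open>n\<close> are 1 modulo \<open>q^(n+1)\<close>.\<close>

lemma qf_cgr_add: "cgr (q ^ Suc n) (qf q (n + j)) (qf q n)"
proof (induction j)
  case (Suc j)
  have *: "qf q (n + Suc j) - qf q n = (qf q (n + j) - qf q n) - q ^ Suc n * (q ^ j * qf q (n + j))"
    by (simp add: qf_Suc algebra_simps power_add)
  show ?case using Suc unfolding cgr_def * by (rule dvd_diff[OF _ dvd_triv_left])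
qed simp

lemma qf_cgr: "n \<le> m \<Longrightarrow> cgr (q ^ Suc n) (qf q m) (qf q n)"
  using qf_cgr_add[of q n "m - n"] by simp

lemma oddf_cgr_add: "cgr (q ^ Suc n) (oddf q (n + j)) (oddf q n)"
proof (induction j)
  case (Suc j)
  have "q ^ (2 * (n + j) + 1) = q ^ Suc n * q ^ (n + 2 * j)"
    unfolding power_add[symmetric] by (rule arg_cong[where f = "power q"]) simp
  then have *: "oddf q (n + Suc j) - oddf q n = (oddf q (n + j) - oddf q n) - q ^ Suc n * (q ^ (n + 2 * j) * oddf q (n + j))"
    by (simp only: oddf_Suc add_Suc_right) (simp add: algebra_simps)
  show ?case using Suc unfolding cgr_def * by (rule dvd_diff[OF _ dvd_triv_left])
qed simp

lemma oddf_cgr: "n \<le> m \<Longrightarrow> cgr (q ^ Suc n) (oddf q m) (oddf q n)"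
  using oddf_cgr_add[of q n "m - n"] by simp

section \<open>From Laurent series identities to power series congruences\<close>

lemma fps_to_fls_sum: "fps_to_fls (sum f A) = (\<Sum>x\<in>A. fps_to_fls (f x :: 'a::comm_ring_1 fps))"
  by (induction A rule: infinite_finite_induct) auto

lemma fps_to_fls_prod: "fps_to_fls (prod f A) = (\<Prod>x\<in>A. fps_to_fls (f x :: 'a::comm_ring_1 fps))"
  by (induction A rule: infinite_finite_induct) (auto simp: fls_times_fps_to_fls)

lemma fps_to_fls_inverse:
  fixes f :: "'a::field fps"
  assumes "f $ 0 \<noteq> 0"
  shows "fps_to_fls (inverse f) = inverse (fps_to_fls f)"
  using assms by (simp add: fls_inverse_fps_to_fls)

lemma fps_to_fls_qf: "fps_to_fls (qf q n) = qf (fps_to_fls q) n"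
  by (simp add: qf_def fps_to_fls_prod fps_to_fls_power)

lemma fps_to_fls_oddf: "fps_to_fls (oddf q n) = oddf (fps_to_fls q) n"
  by (simp add: oddf_def fps_to_fls_prod fps_to_fls_power fls_times_fps_to_fls)

locale fps_nome =
  fixes q :: "'a::field fps"
  assumes q_0: "q $ 0 = 0" and q_nonzero: "q \<noteq> 0"
begin

lemma one_minus_unit [simp]: "n > 0 \<Longrightarrow> (1 - q ^ n) $ 0 = 1"
  using q_0 by (simp add: fps_power_zeroth)

lemma qf_unit [simp]: "qf q n $ 0 = 1"
  using q_0 by (induction n) (simp_all add: qf_Suc fps_power_zeroth)

lemma qf_sq_unit [simp]: "qf (q\<^sup>2) n $ 0 = 1"
  using q_0 by (induction n) (simp_all add: qf_Suc fps_power_zeroth)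

lemma oddf_unit [simp]: "oddf q n $ 0 = 1"
  using q_0 by (induction n) (simp_all add: oddf_Suc fps_power_zeroth)

text \<open>The finite identities divide freely and so live in the field of Laurent series; they are
  pulled back along the injective \<open>fps_to_fls\<close>. No positive power of \<open>q\<close>
  is 1, because \<open>1 - q^n\<close> has constant term 1.\<close>

sublocale fls: not_root_of_unity "fps_to_fls q"
proof
  show "fps_to_fls q \<noteq> 0" using q_nonzero by simp
  fix n :: nat assume "n > 0"
  then have "q ^ n \<noteq> 1" using one_minus_unit[of n] by (metis diff_self fps_zero_nth zero_neq_one)
  then show "fps_to_fls q ^ n \<noteq> 1"
    by (simp add: fps_to_fls_power[symmetric])
qed

lemma fps_to_fls_inverse_one_minus:
  "n > 0 \<Longrightarrow> fps_to_fls (inverse (1 - q ^ n)) = inverse (1 - fps_to_fls q ^ n)"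
  using one_minus_unit[of n] by (subst fps_to_fls_inverse) (simp_all only: fps_to_fls_minus fps_to_fls_power fps_one_to_fls one_neq_zero not_False_eq_True)

lemmas to_fls = fps_to_fls_inverse_one_minus fps_to_fls_sum fps_to_fls_qf fps_to_fls_oddf fps_to_fls_power fls_times_fps_to_fls

lemma bailey_fps:
  "(\<Sum>n=1..N. q ^ n * (qf q (n - 1))\<^sup>2 * (qf (q\<^sup>2) n * inverse (qf q n * qf q (2 * n)))) =
   (\<Sum>n=1..N. q ^ n * (inverse (1 - q ^ n))\<^sup>2) +
   (\<Sum>r=1..N div 2. (-1) ^ r * (q ^ (3 * r\<^sup>2 - r) + q ^ (3 * r\<^sup>2 + r)) *
      (q ^ (2 * r) * (inverse (1 - q ^ (2 * r)))\<^sup>2 *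
        ((qf q N)\<^sup>2 * inverse (qf q (N - 2 * r) * qf q (N + 2 * r)))))" (is "?l = ?a + ?b")
proof -
  have a: "fps_to_fls ?a = (\<Sum>n=1..N. fps_to_fls q ^ n / (1 - fps_to_fls q ^ n)\<^sup>2)"
    unfolding fps_to_fls_sum
    by (intro sum.cong refl) (simp add: to_fls fps_to_fls_inverse divide_inverse power_inverse)
  have b: "fps_to_fls ?b = (\<Sum>r=1..N div 2. (-1) ^ r * (fps_to_fls q ^ (3 * r\<^sup>2 - r) + fps_to_fls q ^ (3 * r\<^sup>2 + r)) *
      (fps_to_fls q ^ (2 * r) / (1 - fps_to_fls q ^ (2 * r))\<^sup>2 *
      ((qf (fps_to_fls q) N)\<^sup>2 / (qf (fps_to_fls q) (N - 2 * r) * qf (fps_to_fls q) (N + 2 * r)))))"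
    unfolding fps_to_fls_sum
    by (intro sum.cong refl) (simp add: to_fls fps_to_fls_inverse divide_inverse power_inverse)
  have l: "fps_to_fls ?l = (\<Sum>n=1..N. fps_to_fls q ^ n * (qf (fps_to_fls q) (n - 1))\<^sup>2 *
      (qf ((fps_to_fls q)\<^sup>2) n / (qf (fps_to_fls q) n * qf (fps_to_fls q) (2 * n))))"
    unfolding fps_to_fls_sum
    by (intro sum.cong refl) (simp add: to_fls fps_to_fls_inverse divide_inverse power_inverse)
  have "fps_to_fls ?l = fps_to_fls (?a + ?b)"
    unfolding fps_to_fls_plus a b l by (rule fls.bailey_closed)
  then show ?thesis by (simp only: fps_to_fls_eq_iff)
qed

text \<open>The quotient of q-factorials is 1 only modulo \<open>q^(N-2r+1)\<close>; the factor
  \<open>q^(2r)\<close> of the summand restores the precision \<open>q^(N+1)\<close>.\<close>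

lemma bailey_cgr:
  "cgr (q ^ Suc N) (\<Sum>n=1..N. q ^ n * (qf q (n - 1))\<^sup>2 * (qf (q\<^sup>2) n * inverse (qf q n * qf q (2 * n))))
   ((\<Sum>n=1..N. q ^ n * (inverse (1 - q ^ n))\<^sup>2) +
   (\<Sum>r=1..N div 2. (-1) ^ r * (q ^ (3 * r\<^sup>2 - r) + q ^ (3 * r\<^sup>2 + r)) *
      (q ^ (2 * r) * (inverse (1 - q ^ (2 * r)))\<^sup>2)))"
  unfolding bailey_fps
proof (intro cgr_add cgr_refl cgr_sum)
  fix r assume "r \<in> {1..N div 2}"
  then have r: "2 * r \<le> N" by auto
  let ?c = "q ^ Suc (N - 2 * r)" and ?Q = "qf q (N - 2 * r)"
  have "cgr ?c ((qf q N)\<^sup>2 * inverse (qf q (N - 2 * r) * qf q (N + 2 * r))) (?Q\<^sup>2 * inverse (?Q * ?Q))"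
    by (intro cgr_mult cgr_power cgr_inverse qf_cgr cgr_refl) simp_all
  also have "?Q\<^sup>2 * inverse (?Q * ?Q) = 1"
    unfolding power2_eq_square by (subst mult.commute, rule inverse_mult_eq_1) simp
  finally have "cgr (q ^ (2 * r) * ?c) (q ^ (2 * r) * ((qf q N)\<^sup>2 * inverse (qf q (N - 2 * r) * qf q (N + 2 * r)))) (q ^ (2 * r) * 1)"
    by (rule cgr_scale)
  moreover have "q ^ (2 * r) * ?c = q ^ Suc N"
    unfolding power_add[symmetric] by (rule arg_cong[where f = "power q"]) (use r in simp)
  ultimately have scaled: "cgr (q ^ Suc N) (q ^ (2 * r) * ((qf q N)\<^sup>2 * inverse (qf q (N - 2 * r) * qf q (N + 2 * r)))) (q ^ (2 * r) * 1)"
    by (simp only:)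
  have "cgr (q ^ Suc N) ((-1) ^ r * (q ^ (3 * r\<^sup>2 - r) + q ^ (3 * r\<^sup>2 + r)) * (inverse (1 - q ^ (2 * r)))\<^sup>2 *
       (q ^ (2 * r) * ((qf q N)\<^sup>2 * inverse (qf q (N - 2 * r) * qf q (N + 2 * r)))))
     ((-1) ^ r * (q ^ (3 * r\<^sup>2 - r) + q ^ (3 * r\<^sup>2 + r)) * (inverse (1 - q ^ (2 * r)))\<^sup>2 * (q ^ (2 * r) * 1))"
    by (rule cgr_mult[OF cgr_refl scaled])
  then show "cgr (q ^ Suc N) ((-1) ^ r * (q ^ (3 * r\<^sup>2 - r) + q ^ (3 * r\<^sup>2 + r)) *
      (q ^ (2 * r) * (inverse (1 - q ^ (2 * r)))\<^sup>2 * ((qf q N)\<^sup>2 * inverse (qf q (N - 2 * r) * qf q (N + 2 * r)))))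
     ((-1) ^ r * (q ^ (3 * r\<^sup>2 - r) + q ^ (3 * r\<^sup>2 + r)) * (q ^ (2 * r) * (inverse (1 - q ^ (2 * r)))\<^sup>2))"
    by (simp only: mult_ac mult_1_left)
qed

lemma prod_inverse_qf:
  assumes "n \<le> m"
  shows "(\<Prod>i\<in>{n<..m}. inverse (1 - q ^ i)) = qf q n * inverse (qf q m)"
  using assms
proof (induction m rule: dec_induct)
  case base
  have "inverse (qf q n) * qf q n = 1" by (rule inverse_mult_eq_1) simp
  then show ?case by (simp add: mult.commute)
next
  case (step m)
  then have "{n<..Suc m} = insert (Suc m) {n<..m}" by auto
  then show ?case using step by (simp add: qf_Suc fps_inverse_mult mult_ac del: power_Suc)
qed

lemma jacobi_fps:
  "(\<Sum>k\<le>n. of_nat (2 * k + 1) * ((-1) ^ k * q ^ (k * (k + 1) div 2)) * inverse (qf q (n - k) * qf q (n + 1 + k))) =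
   (qf q n)\<^sup>2 * inverse (qf q (2 * n + 1))" (is "?l = ?r")
proof -
  have "fps_to_fls ?l = (\<Sum>k\<le>n. of_nat (2 * k + 1) * (fls.tri k * fls.cq n (int k)))"
    unfolding fps_to_fls_sum
  proof (intro sum.cong refl)
    fix k assume "k \<in> {..n}"
    then have k: "k \<le> n" by simp
    have "fls.cq n (int k) = inverse (qf (fps_to_fls q) (n - k)) * inverse (qf (fps_to_fls q) (n + 1 + k))"
    proof -
      have "int n - int k = int (n - k)" "int n + 1 + int k = int (n + 1 + k)" using k by simp_all
      then show ?thesis by (simp only: fls.cq_def fls.iqf_nat)
    qed
    then show "fps_to_fls (of_nat (2 * k + 1) * ((-1) ^ k * q ^ (k * (k + 1) div 2)) * inverse (qf q (n - k) * qf q (n + 1 + k)))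
       = of_nat (2 * k + 1) * (fls.tri k * fls.cq n (int k))"
      by (simp add: to_fls fps_to_fls_inverse fls.tri_def del: of_nat_add of_nat_mult of_nat_Suc)
  qed
  also have "\<dots> = fps_to_fls ?r"
    unfolding fls.jacobi_finite by (simp add: to_fls fps_to_fls_inverse divide_inverse)
  finally show ?thesis by (simp only: fps_to_fls_eq_iff)
qed

text \<open>Multiply \<open>jacobi_fps\<close> by \<open>qf q n * qf q (2n+1)\<close>. The resulting
  quotient in summand \<open>k\<close> is 1 modulo \<open>q^(n-k+1)\<close>, and
  \<open>q^(k(k+1)/2)\<close> makes up for the missing \<open>k\<close> orders.\<close>

lemma jacobi_cgr:
  "cgr (q ^ Suc n) ((qf q n) ^ 3) (\<Sum>k\<le>n. of_nat (2 * k + 1) * ((-1) ^ k * q ^ (k * (k + 1) div 2)))"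
proof -
  let ?d = "\<lambda>k. of_nat (2 * k + 1) * (-1) ^ k :: 'a fps"
  have "(qf q n) ^ 3 = (qf q n) ^ 3 * (inverse (qf q (2 * n + 1)) * qf q (2 * n + 1))"
    by (subst inverse_mult_eq_1) simp_all
  also have "\<dots> = qf q n * qf q (2 * n + 1) * ((qf q n)\<^sup>2 * inverse (qf q (2 * n + 1)))"
    by (simp only: power2_eq_square power3_eq_cube mult_ac)
  also have "\<dots> = (\<Sum>k\<le>n. ?d k * (q ^ (k * (k + 1) div 2) *
     (qf q n * qf q (2 * n + 1) * inverse (qf q (n - k) * qf q (n + 1 + k)))))"
    unfolding jacobi_fps[symmetric] sum_distrib_left by (simp only: mult_ac)
  finally have eq: "(qf q n) ^ 3 = \<dots>" .
  have "cgr (q ^ Suc n) ((qf q n) ^ 3) (\<Sum>k\<le>n. ?d k * (q ^ (k * (k + 1) div 2) * 1))"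
    unfolding eq
  proof (rule cgr_sum, rule cgr_mult[OF cgr_refl])
    fix k assume "k \<in> {..n}"
    then have k: "k \<le> n" by simp
    let ?c = "q ^ Suc (n - k)" and ?Q = "qf q (n - k)"
    have "cgr ?c (qf q n * qf q (2 * n + 1) * inverse (qf q (n - k) * qf q (n + 1 + k)))
        (?Q * ?Q * inverse (?Q * ?Q))"
      by (intro cgr_mult cgr_power cgr_inverse qf_cgr cgr_refl) simp_all
    also have "?Q * ?Q * inverse (?Q * ?Q) = 1"
      by (subst mult.commute, rule inverse_mult_eq_1) simp
    finally have "cgr (q ^ (k * (k + 1) div 2) * ?c) (q ^ (k * (k + 1) div 2) * (qf q n * qf q (2 * n + 1) *
       inverse (qf q (n - k) * qf q (n + 1 + k)))) (q ^ (k * (k + 1) div 2) * 1)"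
      by (rule cgr_scale)
    moreover have "q ^ Suc n dvd q ^ (k * (k + 1) div 2) * ?c"
    proof -
      have "k \<le> k * (k + 1) div 2" by (induction k) auto
      then have "Suc n \<le> k * (k + 1) div 2 + Suc (n - k)" using k by linarith
      then show ?thesis unfolding power_add[symmetric] by (rule le_imp_power_dvd)
    qed
    ultimately show "cgr (q ^ Suc n) (q ^ (k * (k + 1) div 2) * (qf q n * qf q (2 * n + 1) *
       inverse (qf q (n - k) * qf q (n + 1 + k)))) (q ^ (k * (k + 1) div 2) * 1)"
      by (rule cgr_mono)
  qed
  then show ?thesis by (simp only: mult_1_right mult.assoc)
qed

definition wps :: "nat \<Rightarrow> 'a fps" where "wps n = oddf q n * inverse (qf (q\<^sup>2) n)"

definition tps :: "nat \<Rightarrow> 'a fps" where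
  "tps k = q ^ k * (1 + q ^ (2 * k + 1)) * (inverse (1 - q ^ (2 * k + 1)))\<^sup>2"

lemma fps_to_fls_wps: "fps_to_fls (wps n) = fls.wq n"
  by (simp add: wps_def fls.wq_def to_fls fps_to_fls_inverse divide_inverse)

lemma fps_to_fls_tps: "fps_to_fls (tps n) = fls.tq n"
  by (simp add: tps_def fls.tq_def to_fls fps_to_fls_inverse divide_inverse power_inverse del: power_Suc)

lemma lambert_fps:
  "(\<Sum>k\<le>N. tps k * wps (N + k + 1) * wps (N - k)) * (wps N)\<^sup>2 * (1 - q ^ (2 * N + 1))\<^sup>2 = 1" (is "?l = 1")
proof -
  have "fps_to_fls ?l = fps_to_fls 1"
    using fls.lambert_sum[of N]
    by (simp add: to_fls fps_to_fls_wps fps_to_fls_tps del: power_Suc)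
  then show ?thesis by (simp only: fps_to_fls_eq_iff)
qed

lemma wps_cgr: "n \<le> m \<Longrightarrow> cgr (q ^ Suc n) (wps m) (wps n)"
  unfolding wps_def
proof (intro cgr_mult cgr_inverse oddf_cgr)
  assume "n \<le> m"
  have "q ^ Suc n dvd (q\<^sup>2) ^ Suc n"
    unfolding power_mult[symmetric] by (rule le_imp_power_dvd) simp
  then show "cgr (q ^ Suc n) (qf (q\<^sup>2) m) (qf (q\<^sup>2) n)"
    by (rule cgr_mono[OF qf_cgr[OF \<open>n \<le> m\<close>]])
qed simp_all

text \<open>Replacing \<open>wps (N+k+1)\<close> and \<open>wps (N-k)\<close> by
  \<open>wps N\<close> in \<open>lambert_fps\<close> costs \<open>k\<close> orders of precision,
  repaid by the factor \<open>q^k\<close> of \<open>tps k\<close>.\<close>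

lemma lambert_cgr: "cgr (q ^ Suc N) ((\<Sum>k\<le>N. tps k) * (wps N) ^ 4) 1"
proof -
  have "cgr (q ^ Suc N) (\<Sum>k\<le>N. tps k * (wps (N + k + 1) * wps (N - k))) (\<Sum>k\<le>N. tps k * (wps N * wps N))"
  proof (rule cgr_sum)
    fix k assume "k \<in> {..N}"
    then have k: "k \<le> N" by simp
    let ?c = "q ^ Suc (N - k)"
    have "cgr ?c (wps (N + k + 1) * wps (N - k)) (wps (N - k) * wps (N - k))"
      by (intro cgr_mult wps_cgr) simp_all
    also have "cgr ?c (wps (N - k) * wps (N - k)) (wps N * wps N)"
      by (intro cgr_mult cgr_sym[OF wps_cgr]) simp_all
    finally have "cgr (q ^ k * ?c) (q ^ k * (wps (N + k + 1) * wps (N - k))) (q ^ k * (wps N * wps N))"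
      by (rule cgr_scale)
    moreover have "q ^ k * ?c = q ^ Suc N"
      unfolding power_add[symmetric] by (rule arg_cong[where f = "power q"]) (use k in simp)
    ultimately have scaled: "cgr (q ^ Suc N) (q ^ k * (wps (N + k + 1) * wps (N - k))) (q ^ k * (wps N * wps N))"
      by (simp only:)
    have "cgr (q ^ Suc N) ((1 + q ^ (2 * k + 1)) * (inverse (1 - q ^ (2 * k + 1)))\<^sup>2 * (q ^ k * (wps (N + k + 1) * wps (N - k))))
       ((1 + q ^ (2 * k + 1)) * (inverse (1 - q ^ (2 * k + 1)))\<^sup>2 * (q ^ k * (wps N * wps N)))"
      by (rule cgr_mult[OF cgr_refl scaled])
    then show "cgr (q ^ Suc N) (tps k * (wps (N + k + 1) * wps (N - k))) (tps k * (wps N * wps N))"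
      unfolding tps_def by (simp only: mult_ac)
  qed
  moreover have "cgr (q ^ Suc N) (1 - q ^ (2 * N + 1)) 1"
  proof -
    have "q ^ Suc N dvd q ^ (2 * N + 1)" by (rule le_imp_power_dvd) simp
    then show ?thesis unfolding cgr_def by simp
  qed
  ultimately have "cgr (q ^ Suc N) ((\<Sum>k\<le>N. tps k * (wps (N + k + 1) * wps (N - k))) * (wps N)\<^sup>2 * (1 - q ^ (2 * N + 1))\<^sup>2)
     ((\<Sum>k\<le>N. tps k * (wps N * wps N)) * (wps N)\<^sup>2 * 1\<^sup>2)"
    by (intro cgr_mult cgr_power cgr_refl)
  moreover have "(\<Sum>k\<le>N. tps k * (wps N * wps N)) * (wps N)\<^sup>2 * 1\<^sup>2 = (\<Sum>k\<le>N. tps k) * (wps N) ^ 4"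
    by (simp add: sum_distrib_right[symmetric] power2_eq_square power4_eq_xxxx mult_ac)
  ultimately show ?thesis
    using lambert_fps[of N] by (simp only: mult.assoc[of "tps _"] cgr_sym)
qed

text \<open>With \<open>e = qf (q^2) n\<close> and \<open>o' = oddf q n\<close>, the sum is
  \<open>(e / o')^4\<close> by \<open>lambert_cgr\<close>, and the denominator is
  \<open>o' e\<close> by \<open>qf_double\<close>, both modulo \<open>q^(n+1)\<close>.\<close>

lemma lambert_quotient_cgr:
  "cgr (q ^ Suc n) (inverse (qf q (2 * n + 1)) * (\<Sum>k\<le>n. tps k)) ((qf (q\<^sup>2) n) ^ 3 * inverse (oddf q n) ^ 5)"
proof -
  define e o' T where "e = qf (q\<^sup>2) n" and "o' = oddf q n" and "T = (\<Sum>k\<le>n. tps k)"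
  have inv: "inverse e * e = 1" "inverse o' * o' = 1"
    unfolding e_def o'_def by (rule inverse_mult_eq_1, simp)+
  have "wps n ^ 4 * (e * inverse o') ^ 4 = ((inverse e * e) * (inverse o' * o')) ^ 4"
    unfolding wps_def e_def[symmetric] o'_def[symmetric] power_mult_distrib[symmetric] by (simp only: mult_ac)
  then have w: "wps n ^ 4 * (e * inverse o') ^ 4 = 1" unfolding inv by simp
  have "cgr (q ^ Suc n) (T * wps n ^ 4 * (e * inverse o') ^ 4) (1 * (e * inverse o') ^ 4)"
    unfolding T_def by (intro cgr_mult lambert_cgr cgr_refl)
  then have T: "cgr (q ^ Suc n) T ((e * inverse o') ^ 4)"
    unfolding mult.assoc w by simp
  \<comment> \<open>\<open>qf_double\<close> speaks of the even index \<open>2n\<close>; at this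
    precision \<open>2n\<close> and \<open>2n + 1\<close> give the same product.\<close>
  have "cgr (q ^ Suc n) (qf q (2 * n + 1)) (qf q n)" "cgr (q ^ Suc n) (qf q (2 * n)) (qf q n)"
    by (rule qf_cgr, simp)+
  then have "cgr (q ^ Suc n) (qf q (2 * n + 1)) (qf q (2 * n))"
    using cgr_sym cgr_trans by blast
  then have "cgr (q ^ Suc n) (inverse (qf q (2 * n + 1))) (inverse (qf q (2 * n)))"
    by (rule cgr_inverse) simp_all
  from cgr_mult[OF this T]
  have "cgr (q ^ Suc n) (inverse (qf q (2 * n + 1)) * T) (inverse (o' * e) * (e * inverse o') ^ 4)"
    unfolding qf_double e_def o'_def .
  also have "inverse (o' * e) * (e * inverse o') ^ 4 = (inverse e * e) * (e ^ 3 * inverse o' ^ 5)"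
    unfolding fps_inverse_mult power_mult_distrib by (simp only: numeral_eq_Suc power_Suc power_0 pred_numeral_simps mult_ac BitM.simps mult_1_right)
  finally show ?thesis unfolding inv mult_1_left unfolding e_def o'_def T_def .
qed

end

section \<open>The odd coefficients modulo 5\<close>

definition supp :: "nat \<Rightarrow> 'a::zero fps \<Rightarrow> bool" where
  "supp d f \<longleftrightarrow> (\<forall>n. \<not> d dvd n \<longrightarrow> f $ n = 0)"

lemma suppD: "supp d f \<Longrightarrow> \<not> d dvd n \<Longrightarrow> f $ n = 0"
  by (simp add: supp_def)

lemma supp_const [intro]: "supp d 0" "supp d (1 :: 'a::comm_ring_1 fps)" "supp d (numeral k :: 'a fps)" "supp d (of_nat j :: 'a fps)"
  by (auto simp: supp_def fps_numeral_nth fps_of_nat[symmetric])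

lemma supp_X_power [intro]: "d dvd k \<Longrightarrow> supp d (fps_X ^ k :: 'a::comm_ring_1 fps)"
  by (auto simp: supp_def)

lemma supp_add [intro]: "supp d f \<Longrightarrow> supp d g \<Longrightarrow> supp d (f + g :: 'a::comm_ring_1 fps)"
  and supp_diff [intro]: "supp d f \<Longrightarrow> supp d g \<Longrightarrow> supp d (f - g)"
  and supp_uminus [intro]: "supp d f \<Longrightarrow> supp d (- f)"
  by (auto simp: supp_def)

lemma supp_mult [intro]:
  fixes f g :: "'a::comm_ring_1 fps"
  assumes "supp d f" "supp d g"
  shows "supp d (f * g)"
  unfolding supp_def
proof (intro allI impI)
  fix n assume n: "\<not> d dvd n"
  have "f $ i * g $ (n - i) = 0" if i: "i \<in> {0..n}" for i
  proof (cases "d dvd i")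
    case True
    then have "\<not> d dvd n - i" using n i by (metis atLeastAtMost_iff dvd_diffD)
    then show ?thesis using suppD[OF assms(2)] by simp
  next
    case False
    then show ?thesis using suppD[OF assms(1)] by simp
  qed
  then show "(f * g) $ n = 0" unfolding fps_mult_nth by (rule sum.neutral[OF ballI])
qed

lemma supp_power [intro]: "supp d f \<Longrightarrow> supp d (f ^ n :: 'a::comm_ring_1 fps)"
  by (induction n) auto

lemma supp_sum [intro]: "(\<And>i. i \<in> I \<Longrightarrow> supp d (f i)) \<Longrightarrow> supp d (sum f I :: 'a::comm_ring_1 fps)"
  by (induction I rule: infinite_finite_induct) auto

lemma supp_prod [intro]: "(\<And>i. i \<in> I \<Longrightarrow> supp d (f i)) \<Longrightarrow> supp d (prod f I :: 'a::comm_ring_1 fps)"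
  by (induction I rule: infinite_finite_induct) auto

text \<open>The equation \<open>f * inverse f = 1\<close> expresses coefficient \<open>n\<close> of
  the inverse by earlier ones; if \<open>d\<close> divides \<open>i\<close> but not
  \<open>n\<close>, it does not divide \<open>n - i\<close>.\<close>

lemma supp_inverse [intro]:
  fixes f :: "'a::field fps"
  assumes "supp d f" "f $ 0 \<noteq> 0"
  shows "supp d (inverse f)"
proof -
  have "inverse f $ n = 0" if "\<not> d dvd n" for n
    using that
  proof (induction n rule: less_induct)
    case (less n)
    then have n: "n > 0" by (auto intro!: Nat.gr0I)
    have "0 = (f * inverse f) $ n"
      using n inverse_mult_eq_1[OF assms(2)] by (simp add: mult.commute)
    also have "\<dots> = f $ 0 * inverse f $ n + (\<Sum>i\<in>{1..n}. f $ i * inverse f $ (n - i))"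
      unfolding fps_mult_nth by (subst sum.atLeast_Suc_atMost) simp_all
    also have "(\<Sum>i\<in>{1..n}. f $ i * inverse f $ (n - i)) = 0"
    proof (rule sum.neutral, rule ballI)
      fix i assume i: "i \<in> {1..n}"
      show "f $ i * inverse f $ (n - i) = 0"
      proof (cases "d dvd i")
        case True
        then have "\<not> d dvd n - i" using less.prems i by (metis atLeastAtMost_iff dvd_diffD)
        moreover have "n - i < n" using i by auto
        ultimately show ?thesis using less.IH by simp
      next
        case False
        then show ?thesis using suppD[OF assms(1)] by simp
      qed
    qed
    finally show ?case using assms(2) by simp
  qed
  then show ?thesis by (simp add: supp_def)
qed

section \<open>The odd part of the generating function\<close>

interpretation X1: fps_nome "fps_X :: 'a::field fps"
  by standard simp_all

interpretation X2: fps_nome "fps_X\<^sup>2 :: 'a::field fps"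
  by standard (simp_all add: fps_power_zeroth)

interpretation X4: fps_nome "(fps_X\<^sup>2)\<^sup>2 :: 'a::field fps"
  by standard (simp_all add: fps_power_zeroth)

text \<open>With \<open>u = 1 - X^n\<close> and \<open>a = qf X (n-1)\<close>, the rewriting
  \<open>u^(-2) (a u) = a^2 / (a u)\<close> exposes the closed form of \<open>beta_sum n\<close>,
  ready for \<open>bailey_cgr\<close>.\<close>

lemma spt_omega_qf:
  assumes "0 < m" "m \<le> M"
  shows "(of_nat (spt_omega m) :: 'a::field) =
    (inverse (qf (fps_X\<^sup>2) M) * (\<Sum>n=1..M. fps_X ^ n * (qf fps_X (n - 1))\<^sup>2 * (qf (fps_X\<^sup>2) n * inverse (qf fps_X n * qf fps_X (2 * n))))) $ m"
proof -
  have "fps_X ^ n * (inverse (1 - fps_X ^ n))\<^sup>2 * ((\<Prod>i\<in>{n<..2 * n}. inverse (1 - fps_X ^ i)) *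
       (\<Prod>j\<in>{n<..M}. inverse (1 - (fps_X\<^sup>2) ^ j))) =
     inverse (qf (fps_X\<^sup>2) M) * (fps_X ^ n * (qf fps_X (n - 1))\<^sup>2 * (qf (fps_X\<^sup>2) n * inverse (qf fps_X n * qf fps_X (2 * n))) :: 'a fps)"
    if "n \<in> {1..M}" for n
  proof -
    define u a :: "'a fps" where "u = 1 - fps_X ^ n" and "a = qf fps_X (n - 1)"
    have n: "n \<le> M" "n \<le> 2 * n" "n > 0" using that by auto
    have P: "(\<Prod>i\<in>{n<..2 * n}. inverse (1 - fps_X ^ i :: 'a fps)) = qf fps_X n * inverse (qf fps_X (2 * n))"
      "(\<Prod>j\<in>{n<..M}. inverse (1 - (fps_X\<^sup>2) ^ j :: 'a fps)) = qf (fps_X\<^sup>2) n * inverse (qf (fps_X\<^sup>2) M)"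
      by (rule X1.prod_inverse_qf X2.prod_inverse_qf, fact)+
    have Q: "qf fps_X n = a * u"
      using qf_Suc[of "fps_X :: 'a fps" "n - 1"] n by (simp add: a_def u_def del: power_Suc)
    have inv: "inverse u * u = 1" "inverse a * a = 1"
      using n by (intro inverse_mult_eq_1; simp add: u_def a_def)+
    have "(inverse u)\<^sup>2 * (a * u) = inverse u * a * (inverse u * u)"
      by (simp only: power2_eq_square mult_ac)
    also have "\<dots> = inverse u * a * (inverse a * a)" unfolding inv ..
    also have "\<dots> = a\<^sup>2 * inverse (a * u)"
      by (simp only: power2_eq_square fps_inverse_mult mult_ac)
    finally have E: "(inverse u)\<^sup>2 * (a * u) = a\<^sup>2 * inverse (a * u)" .
    have "fps_X ^ n * (inverse u)\<^sup>2 * ((a * u * inverse (qf fps_X (2 * n))) * (qf (fps_X\<^sup>2) n * inverse (qf (fps_X\<^sup>2) M)))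
       = fps_X ^ n * ((inverse u)\<^sup>2 * (a * u)) * (inverse (qf fps_X (2 * n)) * (qf (fps_X\<^sup>2) n * inverse (qf (fps_X\<^sup>2) M)))"
      by (simp only: mult_ac)
    then show ?thesis
      unfolding P u_def[symmetric] a_def[symmetric] Q E
      unfolding fps_inverse_mult by (simp only: mult_ac)
  qed
  then show ?thesis
    unfolding spt_omega_gf[OF assms] sum_distrib_left by (intro arg_cong2[where f = fps_nth] sum.cong refl)
qed

text \<open>For \<open>i = 2k + 1\<close> and \<open>x = X^i\<close>,
  \<open>x / (1 - x)^2 = (x (1 + x^2) + 2 x^2) / (1 - x^2)^2\<close>. The first part is
  \<open>X * X2.tps k\<close>; the second is the even series \<open>g i\<close>.\<close>

lemma lambert_odd_part:
  "\<exists>E. supp 2 E \<and> (\<Sum>i=1..2 * n + 1. fps_X ^ i * (inverse (1 - fps_X ^ i))\<^sup>2) = fps_X * (\<Sum>k\<le>n. X2.tps k) + (E :: 'a::field fps)"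
proof -
  define f :: "nat \<Rightarrow> 'a fps" where "f = (\<lambda>i. fps_X ^ i * (inverse (1 - fps_X ^ i))\<^sup>2)"
  define g :: "nat \<Rightarrow> 'a fps" where "g = (\<lambda>i. 2 * fps_X ^ (2 * i) * (inverse (1 - fps_X ^ (2 * i)))\<^sup>2)"
  have s1: "supp 2 (f (2 * k))" if "k > 0" for k
    unfolding f_def using that by (auto intro!: supp_mult supp_power[of _ _ 2] supp_inverse supp_diff)
  have s2: "supp 2 (g k)" if "k > 0" for k
    unfolding g_def using that by (auto intro!: supp_mult supp_power[of _ _ 2] supp_inverse supp_diff)
  have odd: "f (2 * k + 1) = fps_X * X2.tps k + g (2 * k + 1)" for k
  proof -
    define x :: "'a fps" where "x = fps_X ^ (2 * k + 1)"
    have e: "fps_X ^ (2 * (2 * k + 1)) = x\<^sup>2" "(fps_X\<^sup>2) ^ (2 * k + 1) = x\<^sup>2"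
      unfolding x_def power_mult[symmetric] by (simp_all only: mult.commute)
    have e2: "fps_X * (fps_X\<^sup>2) ^ k = x" unfolding x_def power_mult[symmetric] by simp
    have inv: "inverse (1 + x) * (1 + x) = 1"
      by (rule inverse_mult_eq_1) (simp add: x_def)
    have "1 - x\<^sup>2 = (1 - x) * (1 + x)" by (simp add: power2_eq_square algebra_simps)
    then have i: "inverse (1 - x\<^sup>2) = inverse (1 - x) * inverse (1 + x)" by (simp only: fps_inverse_mult)
    have "fps_X * X2.tps k + g (2 * k + 1) = (fps_X * (fps_X\<^sup>2) ^ k) * (1 + x\<^sup>2) * (inverse (1 - x\<^sup>2))\<^sup>2 + 2 * x\<^sup>2 * (inverse (1 - x\<^sup>2))\<^sup>2"
      unfolding X2.tps_def g_def e by (simp only: mult_ac)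
    also have "\<dots> = x * (inverse (1 - x))\<^sup>2 * (inverse (1 + x) * (1 + x))\<^sup>2"
      unfolding e2 i by (simp add: power2_eq_square algebra_simps)
    also have "\<dots> = x * (inverse (1 - x))\<^sup>2" unfolding inv by simp
    also have "\<dots> = f (2 * k + 1)" unfolding f_def x_def ..
    finally show ?thesis by simp
  qed
  define E where "E = (\<Sum>k\<le>n. g (2 * k + 1)) + (\<Sum>k=1..n. f (2 * k))"
  have "(\<Sum>i=1..2 * n + 1. f i) = (\<Sum>k\<le>n. f (2 * k + 1)) + (\<Sum>k=1..n. f (2 * k))"
    by (induction n) (simp_all add: add_ac)
  also have "\<dots> = fps_X * (\<Sum>k\<le>n. X2.tps k) + E"
    unfolding odd E_def sum.distrib sum_distrib_left by (simp only: add_ac)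
  finally have "(\<Sum>i=1..2 * n + 1. f i) = fps_X * (\<Sum>k\<le>n. X2.tps k) + E" .
  moreover have "supp 2 E"
    unfolding E_def by (intro supp_add supp_sum s1 s2) auto
  ultimately show ?thesis unfolding f_def by blast
qed

lemma supp_qf_sq: "supp 2 (qf (fps_X\<^sup>2 :: 'a::field fps) n)"
  unfolding qf_def power_mult[symmetric] by (intro supp_prod supp_diff supp_const supp_X_power) simp

text \<open>The prefactor is even, and so is the remainder \<open>B\<close> from Bailey's lemma,
  because \<open>2r\<close>, \<open>3r^2 - r\<close> and \<open>3r^2 + r\<close> are even. Hence
  only the term with the extra \<open>X\<close> reaches an odd coefficient.\<close>

lemma spt_omega_odd_coeff:
  "(of_nat (spt_omega (2 * n + 1)) :: 'a::field) =
    (inverse (qf (fps_X\<^sup>2) (2 * n + 1)) * (\<Sum>k\<le>n. X2.tps k)) $ (2 * n)"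
proof -
  \<comment> \<open>At once the coefficient in question, the bound on the parts and the order of
    truncation; a congruence modulo \<open>X^(m+1)\<close> just suffices.\<close>
  define m where "m = 2 * n + 1"
  define I :: "'a fps" where "I = inverse (qf (fps_X\<^sup>2) m)"
  define B :: "'a fps" where "B = (\<Sum>r=1..m div 2. (-1) ^ r * (fps_X ^ (3 * r\<^sup>2 - r) + fps_X ^ (3 * r\<^sup>2 + r)) *
      (fps_X ^ (2 * r) * (inverse (1 - fps_X ^ (2 * r)))\<^sup>2))"
  obtain E :: "'a fps" where E: "supp 2 E" and
    odd: "(\<Sum>i=1..m. fps_X ^ i * (inverse (1 - fps_X ^ i))\<^sup>2) = fps_X * (\<Sum>k\<le>n. X2.tps k) + E"
    using lambert_odd_part[of n] unfolding m_def by blast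
  have "even (3 * r\<^sup>2 - r)" "even (3 * r\<^sup>2 + r)" for r :: nat
    by (cases "even r"; simp)+
  then have B: "supp 2 B"
    unfolding B_def
    by (intro supp_sum supp_mult supp_power[of _ _ 2] supp_inverse supp_add supp_diff supp_X_power
        supp_power[of _ "- 1"] supp_uminus supp_const) auto
  have I: "supp 2 I" unfolding I_def by (intro supp_inverse supp_qf_sq) simp
  let ?S = "\<Sum>n=1..m. fps_X ^ n * (qf fps_X (n - 1))\<^sup>2 * (qf (fps_X\<^sup>2) n * inverse (qf fps_X n * qf fps_X (2 * n)))"
  have c: "cgr (fps_X ^ Suc m) (I * ?S) (I * (fps_X * (\<Sum>k\<le>n. X2.tps k) + E + B))"
    using X1.bailey_cgr[of m, where 'a = 'a] unfolding odd B_def by (rule cgr_mult[OF cgr_refl])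
  have "(of_nat (spt_omega m) :: 'a) = (I * ?S) $ m"
    unfolding I_def by (rule spt_omega_qf) (simp_all add: m_def)
  also have "\<dots> = (I * (fps_X * (\<Sum>k\<le>n. X2.tps k) + E + B)) $ m"
    by (rule cgr_nth[OF c]) simp
  also have "I * (fps_X * (\<Sum>k\<le>n. X2.tps k) + E + B) = fps_X * (I * (\<Sum>k\<le>n. X2.tps k)) + I * (E + B)"
    by (simp add: algebra_simps)
  also have "\<dots> $ m = (I * (\<Sum>k\<le>n. X2.tps k)) $ (2 * n) + (I * (E + B)) $ m"
    by (simp add: m_def)
  also have "(I * (E + B)) $ m = 0"
    by (rule suppD[of 2]) (use I E B in \<open>auto simp: m_def\<close>)
  finally show ?thesis by (simp add: I_def m_def)
qed

section \<open>Reduction modulo 5\<close>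

lemma supp_oddf_power_5:
  assumes "(5 :: 'a::field) = 0"
  shows "supp 10 ((oddf (fps_X\<^sup>2 :: 'a fps) n) ^ 5)"
proof -
  have five: "(5 :: 'a fps) = 0"
    using assms by (simp add: fps_eq_iff fps_numeral_nth)
  \<comment> \<open>The Frobenius map in characteristic 5, with the middle binomial terms written
    out as a multiple of 5.\<close>
  have frob: "(1 - x) ^ 5 = 1 - x ^ 5" for x :: "'a fps"
  proof -
    have "(1 - x) ^ 5 = 1 - x ^ 5 + 5 * (2 * x ^ 2 - x - 2 * x ^ 3 + x ^ 4)"
      by (simp add: numeral_eq_Suc algebra_simps)
    then show ?thesis using five by simp
  qed
  have X: "((fps_X\<^sup>2) ^ (2 * i + 1)) ^ 5 = (fps_X :: 'a fps) ^ (10 * (2 * i + 1))" for i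
    unfolding power_mult[symmetric] by (rule arg_cong[where f = "power fps_X"]) simp
  show ?thesis
    unfolding oddf_def prod_power_distrib frob X
    by (intro supp_prod supp_diff supp_const supp_X_power) simp
qed

text \<open>The residues missed, 3 and 4, become 7 and 9 modulo 10 under
  \<open>n -> 2n + 1\<close>.\<close>

lemma mult_Suc_mod_5: "(k * (k + 1)) mod 5 < (3 :: nat)"
proof -
  define a c where "a = k div 5" and "c = k mod 5"
  have k: "k = 5 * a + c" and "c < 5" by (simp_all add: a_def c_def)
  have "k * (k + 1) = c * (c + 1) + 5 * (5 * a * a + 2 * a * c + a)"
    unfolding k by (simp add: algebra_simps)
  then have "(k * (k + 1)) mod 5 = (c * (c + 1)) mod 5" by (simp only: mod_mult_self2)
  moreover have "c = 0 \<or> c = 1 \<or> c = 2 \<or> c = 3 \<or> c = 4" using \<open>c < 5\<close> by linarith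
  ultimately show ?thesis by (elim disjE) simp_all
qed
text \<open>To the order needed, the series is Jacobi's sum in base \<open>X^4\<close>, with
  exponents \<open>2k(k+1)\<close>, times a series in \<open>X^10\<close>. A nonzero coefficient at
  \<open>2n\<close> would force \<open>n\<close> to be \<open>k(k+1)\<close> modulo 5 for some
  \<open>k\<close>.\<close>

lemma spt_omega_zero_char_5:
  assumes five: "(5 :: 'a::field) = 0" and n: "n mod 5 = 3 \<or> n mod 5 = 4"
  shows "(of_nat (spt_omega (2 * n + 1)) :: 'a) = 0"
proof -
  let ?g = "inverse (oddf (fps_X\<^sup>2) n) ^ 5 :: 'a fps"
  have "?g = inverse (oddf (fps_X\<^sup>2) n ^ 5)" by (simp add: fps_inverse_power)
  then have g: "supp 10 ?g"
    using supp_oddf_power_5[OF five, of n] by (auto intro!: supp_inverse simp: fps_power_zeroth)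
  \<comment> \<open>Jacobi's formula holds modulo \<open>(X^4)^(n+1)\<close>; it is weakened to the
    order \<open>(X^2)^(n+1)\<close> of \<open>lambert_quotient_cgr\<close>, which still exceeds
    \<open>2n\<close>.\<close>
  have "cgr ((fps_X\<^sup>2) ^ Suc n) (qf ((fps_X\<^sup>2)\<^sup>2) n ^ 3 :: 'a fps)
      (\<Sum>k\<le>n. of_nat (2 * k + 1) * ((-1) ^ k * ((fps_X\<^sup>2)\<^sup>2) ^ (k * (k + 1) div 2)))"
  proof (rule cgr_mono[OF X4.jacobi_cgr])
    show "(fps_X\<^sup>2) ^ Suc n dvd (((fps_X\<^sup>2)\<^sup>2) ^ Suc n :: 'a fps)"
      unfolding power_mult[symmetric] by (rule le_imp_power_dvd) simp
  qed
  then have "cgr ((fps_X\<^sup>2) ^ Suc n) (inverse (qf (fps_X\<^sup>2) (2 * n + 1)) * (\<Sum>k\<le>n. X2.tps k) :: 'a fps)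
     ((\<Sum>k\<le>n. of_nat (2 * k + 1) * ((-1) ^ k * ((fps_X\<^sup>2)\<^sup>2) ^ (k * (k + 1) div 2))) * ?g)"
    by (rule cgr_trans[OF X2.lambert_quotient_cgr cgr_mult[OF _ cgr_refl]])
  then have "cgr (fps_X ^ (2 * Suc n)) (inverse (qf (fps_X\<^sup>2) (2 * n + 1)) * (\<Sum>k\<le>n. X2.tps k) :: 'a fps)
     ((\<Sum>k\<le>n. of_nat (2 * k + 1) * ((-1) ^ k * ((fps_X\<^sup>2)\<^sup>2) ^ (k * (k + 1) div 2))) * ?g)"
    unfolding power_mult .
  then have "(inverse (qf (fps_X\<^sup>2) (2 * n + 1)) * (\<Sum>k\<le>n. X2.tps k) :: 'a fps) $ (2 * n) =
      ((\<Sum>k\<le>n. of_nat (2 * k + 1) * ((-1) ^ k * ((fps_X\<^sup>2)\<^sup>2) ^ (k * (k + 1) div 2))) * ?g) $ (2 * n)"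
    by (rule cgr_nth) simp
  also have "\<dots> = (\<Sum>k\<le>n. (of_nat (2 * k + 1) * ((-1) ^ k * ((fps_X\<^sup>2)\<^sup>2) ^ (k * (k + 1) div 2)) * ?g) $ (2 * n))"
    unfolding sum_distrib_right fps_sum_nth ..
  also have "\<dots> = 0"
  proof (rule sum.neutral, rule ballI)
    fix k
    let ?h = "of_nat (2 * k + 1) * ((-1) ^ k * ?g) :: 'a fps"
    have h: "supp 10 ?h"
      by (intro supp_mult supp_const supp_power supp_uminus g)
    have ex: "2 * (2 * (k * (k + 1) div 2)) = 2 * (k * (k + 1))" by simp
    have X: "((fps_X\<^sup>2)\<^sup>2) ^ (k * (k + 1) div 2) = (fps_X :: 'a fps) ^ (2 * (k * (k + 1)))"
      unfolding power_mult[symmetric] mult.assoc ex ..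
    have "of_nat (2 * k + 1) * ((-1) ^ k * ((fps_X\<^sup>2)\<^sup>2) ^ (k * (k + 1) div 2)) * ?g = fps_X ^ (2 * (k * (k + 1))) * ?h"
      unfolding X by (simp only: mult_ac)
    moreover have "\<not> 10 dvd 2 * n - 2 * (k * (k + 1))" if "2 * (k * (k + 1)) \<le> 2 * n"
    proof
      assume "10 dvd 2 * n - 2 * (k * (k + 1))"
      then obtain c where "2 * n - 2 * (k * (k + 1)) = 10 * c" by (elim dvdE)
      then have "n = k * (k + 1) + 5 * c" using that by simp
      then have "n mod 5 = (k * (k + 1)) mod 5" by (simp only: mod_mult_self2)
      then show False using n mult_Suc_mod_5[of k] by linarith
    qed
    ultimately show "(of_nat (2 * k + 1) * ((-1) ^ k * ((fps_X\<^sup>2)\<^sup>2) ^ (k * (k + 1) div 2)) * ?g) $ (2 * n) = 0"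
      using suppD[OF h] by (simp only: fps_X_power_mult_nth not_less[symmetric]) auto
  qed
  finally show ?thesis unfolding spt_omega_odd_coeff .
qed

text \<open>\<open>mod_ring\<close> takes its modulus from the cardinality of its argument type.\<close>

typedef five = "{0..<5::nat}"
  by (rule exI[of _ 0]) simp

lemma CARD_five: "CARD(five) = 5"
  using type_definition.card[OF type_definition_five] by simp

instance five :: prime_card
  by standard (simp add: CARD_five)

lemma spt_omega_odd_dvd_5:
  assumes "n mod 5 = 3 \<or> n mod 5 = 4"
  shows "5 dvd spt_omega (2 * n + 1)"
proof -
  have "(5 :: five mod_ring) = of_nat CARD(five)" by (simp add: CARD_five)
  also have "\<dots> = 0" by (rule of_nat_card_eq_0)
  finally have "(of_nat (spt_omega (2 * n + 1)) :: five mod_ring) = 0"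
    by (rule spt_omega_zero_char_5[OF _ assms])
  then have "CARD(five) dvd spt_omega (2 * n + 1)" by (rule of_nat_0_mod_ring_dvd)
  then show ?thesis by (simp add: CARD_five)
qed

theorem theorem6p4:
  fixes n :: nat
  shows "[spt_omega (10 * n + 7) = 0] (mod 5) \<and> [spt_omega (10 * n + 9) = 0] (mod 5)"
proof -
  have e: "10 * n + 7 = 2 * (5 * n + 3) + 1" "10 * n + 9 = 2 * (5 * n + 4) + 1" by simp_all
  show ?thesis
    unfolding e cong_0_iff by (intro conjI spt_omega_odd_dvd_5) simp_all
qed

end
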